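(* Let $\Omega$ be an open, bounded subset of $\mathbb{H}$ satisfying the exterior $\mathbb{H}$-corkscrew condition (with constants $\bar\delta>0$ and $\mu\in(0,1)$), and let $G\in C(\Gamma^{\mathbb{H}}_1)$. For $2\le p<\infty$ and $0<\varepsilon<1$, let $u_\varepsilon$ be the solution of $$u_\varepsilon(x)=\mu^{\mathbb{H}}_p(u_\varepsilon,\varepsilon)(x)\ \text{ if } x\in\Omega,\qquad u_\varepsilon(x)=G(x)\ \text{ if } x\in\Gamma^{\mathbb{H}}_\varepsilon .$$ Given $\eta>0$ there exist $\delta_0=\delta_0(\eta,\mu,p)>0$ and $\varepsilon_0=\varepsilon_0(\eta,\delta,\mu)>0$ such that $$|u_\varepsilon(x)-G(y)|\le\eta$$ for all $y\in\partial\Omega$, $x\in B^{\mathbb{H}}_{\delta_0}(y)\cap\Omega$ and $\varepsilon\le\varepsilon_0$. Here $\delta\in(0,\bar\delta)$ is the uniform continuity scale of $G$ associated with $\eta$, described in the context.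
   Context: Heisenberg group: $\mathbb{H}=(\mathbb{R}^3,* )$ with $(x_1,x_2,x_3)*(y_1,y_2,y_3)=(x_1+y_1,\,x_2+y_2,\,x_3+y_3+\tfrac12(x_1y_2-x_2y_1))$. The Korányi gauge is $|x|_{\mathbb{H}}=((x_1^2+x_2^2)^2+16x_3^2)^{1/4}$, the metric is $d_{\mathbb{H}}(x,y)=|x^{-1}*y|_{\mathbb{H}}$, and $B^{\mathbb{H}}_r(x_0)=\{x\in\mathbb{H}: d_{\mathbb{H}}(x_0,x)<r\}$. Boundary strips: for $0<\varepsilon\le1$, $\Gamma^{\mathbb{H}}_\varepsilon=\{x\in\mathbb{H}\setminus\Omega:\operatorname{dist}_{\mathbb{H}}(x,\Omega)\le\varepsilon\}$ and $\Omega_\varepsilon=\Omega\cup\Gamma^{\mathbb{H}}_\varepsilon$. $\mathcal{B}(\Omega_\varepsilon)$ is the set of bounded Lebesgue measurable real functions on $\Omega_\varepsilon$. Natural $p$-mean: for $1<p<\infty$, $\phi\in\mathcal{B}(\Omega_\varepsilon)$ and $x\in\overline\Omega$, $\mu^{\mathbb{H}}_p(\phi,\varepsilon)(x)$ is the unique real number $\lambda$ minimizing $\|\phi-\lambda\|_{L^p(\overline{B^{\mathbb{H}}_\varepsilon(x)})}$ (with respect to Lebesgue measure on $\mathbb{R}^3$). The boundary value problem in the claim has a unique solution $u_\varepsilon\in\mathcal{B}(\Omega_\varepsilon)$. Exterior $\mathbb{H}$-corkscrew condition for $\Omega$: there exist $\bar\delta>0$ and $\mu\in(0,1)$ such that for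 every $r\in(0,\bar\delta)$ and every $y\in\partial\Omega$ there is a ball $B^{\mathbb{H}}_{\mu r}(z)$ strictly contained in $B^{\mathbb{H}}_r(y)\setminus\Omega$. The number $\delta$: given $\eta>0$, $\delta\in(0,\bar\delta)$ is chosen by uniform continuity of $G$ so that $|G(x)-G(y)|\le\eta/2$ for all $y\in\partial\Omega$, all $x\in B^{\mathbb{H}}_{5\delta}(y)\cap\Gamma^{\mathbb{H}}_\varepsilon$ and all $0<\varepsilon<1$. *)

theory Defs
  imports "HOL-Analysis.Analysis"
begin

text \<open>
  The Heisenberg group lives on \<^typ>\<open>real ^ 3\<close>.  The gauge metric induces the Euclidean topology
  and the same bounded sets, so the library's \<^const>\<open>open\<close>, \<^const>\<open>bounded\<close>, \<^const>\<open>closure\<close>,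
  \<^const>\<open>frontier\<close> and \<^const>\<open>continuous_on\<close> are used unchanged.
\<close>

definition heis_mult :: "real ^ 3 \<Rightarrow> real ^ 3 \<Rightarrow> real ^ 3" where
  "heis_mult x y =
     vector [x $ 1 + y $ 1, x $ 2 + y $ 2, x $ 3 + y $ 3 + (x $ 1 * y $ 2 - x $ 2 * y $ 1) / 2]"

definition heis_inv :: "real ^ 3 \<Rightarrow> real ^ 3" where
  "heis_inv x = - x"

lemma heis_mult_assoc: "heis_mult (heis_mult x y) z = heis_mult x (heis_mult y z)"
  by (simp add: heis_mult_def vec_eq_iff forall_3 field_simps)

lemma heis_mult_0: "heis_mult 0 x = x" "heis_mult x 0 = x"
  by (simp_all add: heis_mult_def vec_eq_iff forall_3)

lemma heis_mult_inv: "heis_mult (heis_inv x) x = 0" "heis_mult x (heis_inv x) = 0"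
  by (simp_all add: heis_mult_def heis_inv_def vec_eq_iff forall_3)

definition koranyi_gauge :: "real ^ 3 \<Rightarrow> real" where
  "koranyi_gauge x = root 4 (((x $ 1)\<^sup>2 + (x $ 2)\<^sup>2)\<^sup>2 + 16 * (x $ 3)\<^sup>2)"

definition heis_dist :: "real ^ 3 \<Rightarrow> real ^ 3 \<Rightarrow> real" where
  "heis_dist x y = koranyi_gauge (heis_mult (heis_inv x) y)"

definition heis_ball :: "real ^ 3 \<Rightarrow> real \<Rightarrow> (real ^ 3) set" where
  "heis_ball x r = {y. heis_dist x y < r}"

definition heis_infdist :: "real ^ 3 \<Rightarrow> (real ^ 3) set \<Rightarrow> real" where
  "heis_infdist x A = (INF a\<in>A. heis_dist x a)"

definition boundary_strip :: "(real ^ 3) set \<Rightarrow> real \<Rightarrow> (real ^ 3) set" where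
  "boundary_strip \<Omega> \<epsilon> = {x. x \<notin> \<Omega> \<and> heis_infdist x \<Omega> \<le> \<epsilon>}"

definition extended_domain :: "(real ^ 3) set \<Rightarrow> real \<Rightarrow> (real ^ 3) set" where
  "extended_domain \<Omega> \<epsilon> = \<Omega> \<union> boundary_strip \<Omega> \<epsilon>"

text \<open>
  A function on a subset \<open>S\<close> is represented by a total function whose values off \<open>S\<close> are irrelevant.
\<close>

definition bounded_measurable_on :: "(real ^ 3) set \<Rightarrow> (real ^ 3 \<Rightarrow> real) set" where
  "bounded_measurable_on S = {\<phi>. \<phi> \<in> borel_measurable (lebesgue_on S) \<and> bounded (\<phi> ` S)}"

definition Lp_norm_on :: "real \<Rightarrow> (real ^ 3) set \<Rightarrow> (real ^ 3 \<Rightarrow> real) \<Rightarrow> real" where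
  "Lp_norm_on p A f = (LINT y:A|lebesgue. \<bar>f y\<bar> powr p) powr (1 / p)"

definition natural_p_mean :: "real \<Rightarrow> (real ^ 3 \<Rightarrow> real) \<Rightarrow> real \<Rightarrow> real ^ 3 \<Rightarrow> real" where
  "natural_p_mean p \<phi> \<epsilon> x =
     (THE m. \<forall>c. Lp_norm_on p (closure (heis_ball x \<epsilon>)) (\<lambda>y. \<phi> y - m)
                  \<le> Lp_norm_on p (closure (heis_ball x \<epsilon>)) (\<lambda>y. \<phi> y - c))"

definition solves_p_mean_bvp ::
  "(real ^ 3) set \<Rightarrow> (real ^ 3 \<Rightarrow> real) \<Rightarrow> real \<Rightarrow> real \<Rightarrow> (real ^ 3 \<Rightarrow> real) \<Rightarrow> bool" where
  "solves_p_mean_bvp \<Omega> G p \<epsilon> u \<longleftrightarrow>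
     u \<in> bounded_measurable_on (extended_domain \<Omega> \<epsilon>) \<and>
     (\<forall>x\<in>\<Omega>. u x = natural_p_mean p u \<epsilon> x) \<and>
     (\<forall>x\<in>boundary_strip \<Omega> \<epsilon>. u x = G x)"

definition exterior_corkscrew :: "(real ^ 3) set \<Rightarrow> real \<Rightarrow> real \<Rightarrow> bool" where
  "exterior_corkscrew \<Omega> \<delta>' \<mu> \<longleftrightarrow>
     0 < \<delta>' \<and> 0 < \<mu> \<and> \<mu> < 1 \<and>
     (\<forall>r y. 0 < r \<and> r < \<delta>' \<and> y \<in> frontier \<Omega> \<longrightarrow>
        (\<exists>z. heis_ball z (\<mu> * r) \<subset> heis_ball y r - \<Omega>))"

text \<open>
  \<open>\<delta>\<close> is an admissible uniform continuity scale of \<open>G\<close> for the tolerance \<open>\<eta>\<close>, where \<open>\<delta>'\<close> is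
  the maximal radius in the corkscrew condition.
\<close>

definition continuity_scale ::
  "(real ^ 3) set \<Rightarrow> (real ^ 3 \<Rightarrow> real) \<Rightarrow> real \<Rightarrow> real \<Rightarrow> real \<Rightarrow> bool" where
  "continuity_scale \<Omega> G \<delta>' \<eta> \<delta> \<longleftrightarrow>
     0 < \<delta> \<and> \<delta> < \<delta>' \<and>
     (\<forall>\<epsilon> y x. 0 < \<epsilon> \<and> \<epsilon> < 1 \<and> y \<in> frontier \<Omega> \<and> x \<in> heis_ball y (5 * \<delta>) \<inter> boundary_strip \<Omega> \<epsilon>
        \<longrightarrow> \<bar>G x - G y\<bar> \<le> \<eta> / 2)"

end

theory Submission
  imports Defs "HOL-Analysis.Analysis"
begin

text \<open>
  Composing a power of the Koranyi gauge with a steep decreasing exponential gives a barrier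
  \<open>W = c - A exp (- b \<bar>z\<inverse> x\<bar>\<^sup>4)\<close> whose natural \<open>p\<close>-means over small balls lie strictly below its values, on
  annuli around \<open>z\<close> and for all \<open>p \<ge> 2\<close> at once.  Indeed the increment of the fourth power of the gauge
  is an odd part \<open>L(h)\<close> plus a remainder of order \<open>T\<close>, with \<open>L\<^sup>2 \<ge> const \<bar>z\<inverse> x\<bar>\<^sup>4 T\<close> on a fixed fraction of
  the ball, also near the vertical axis where the horizontal gradient degenerates.  Pairing \<open>h\<close> with
  \<open>h\<inverse>\<close>, which is a Euclidean point reflection of the ball, the concavity of the exponential profile
  then beats the remainder, and a Chebyshev-type inequality reduces every \<open>p \<ge> 2\<close> to the linear case.

  By comparison with the barrier centred at an exterior corkscrew ball of scale \<open>r\<close>, the excess of \<open>u\<close> over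
  \<open>G y + \<eta> / 2\<close> shrinks by a fixed factor from the ball of radius \<open>5 r\<close> about \<open>y\<close> to the ball of radius
  \<open>r\<close>.  Finitely many iterations give the upper estimate; the lower one follows by passing to \<open>- u\<close>.
\<close>


subsection \<open>Natural \<open>p\<close>-means\<close>

text \<open>The obstacle is that \<open>u\<close> is merely bounded and measurable: its difference
  from a barrier need not attain its supremum, so no argument at a maximum point is available. The
  strict mean value inequality of the barrier is therefore proved with a margin
  \<open>\<kappa>\<close> common to all points of the annulus, and a point where the supremum is
  almost attained is enough. The condition \<open>2 \<le> p\<close> enters through convexity of the
  power \<open>p - 1\<close> on the half line, which lets a tangent replace the odd power. The
  steepness \<open>b\<close> and the bound on \<open>\<epsilon>\<close> are dictated by the annulus
  alone, so they do not involve \<open>p\<close>. By homogeneity of the gauge, the contraction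
  factor of one step depends only on \<open>\<mu>\<close>, while the admissible
  \<open>\<epsilon>\<close> shrinks with the scale. The number of steps must thus be fixed in
  advance; \<open>\<mu>\<close>, \<open>\<eta>\<close> and a bound for \<open>G\<close> determine
  it.\<close>

text \<open>For \<open>a = p - 1\<close> this is the derivative of the \<open>p\<close>-th power of
  the absolute value, divided by \<open>p\<close>. The Euler equation of a \<open>p\<close>-mean
  \<open>m\<close> of \<open>v\<close> says that \<open>signed_powr (p - 1) (v y - m)\<close> has
  integral zero.\<close>

definition signed_powr :: "real \<Rightarrow> real \<Rightarrow> real" where
  "signed_powr a s = sgn s * \<bar>s\<bar> powr a"

lemma signed_powr_minus [simp]: "signed_powr a (- s) = - signed_powr a s"
  by (simp add: signed_powr_def sgn_minus)

lemma signed_powr_nonneg: "0 \<le> s \<Longrightarrow> signed_powr a s = s powr a"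
  by (cases "s = 0") (auto simp: signed_powr_def)

lemma signed_powr_mult: "0 \<le> c \<Longrightarrow> signed_powr a (c * s) = c powr a * signed_powr a s"
  by (cases "c = 0") (auto simp: signed_powr_def sgn_mult abs_mult powr_mult)

lemma signed_powr_strict_mono:
  assumes "0 < a" "s < t"
  shows "signed_powr a s < signed_powr a t"
proof (cases "0 \<le> s")
  case True
  then show ?thesis using assms by (simp add: signed_powr_nonneg powr_less_mono2)
next
  case s: False
  show ?thesis
  proof (cases "0 \<le> t")
    case True
    have "signed_powr a s < 0" using s by (simp add: signed_powr_def)
    then show ?thesis using True by (smt (verit) signed_powr_nonneg powr_ge_zero)
  next
    case False
    then show ?thesis using s assms powr_less_mono2[of a "-t" "-s"] by (simp add: signed_powr_def)
  qed
qed

lemma signed_powr_mono: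
  assumes "0 < a" "s \<le> t"
  shows "signed_powr a s \<le> signed_powr a t"
  using signed_powr_strict_mono[OF assms(1), of s t] assms by (cases "s = t") auto

lemma abs_signed_powr: "\<bar>signed_powr a s\<bar> = \<bar>s\<bar> powr a"
  by (cases "s = 0") (auto simp: signed_powr_def abs_mult)

lemma borel_measurable_signed_powr [measurable]:
  "signed_powr a \<in> borel_measurable borel"
  unfolding signed_powr_def by measurable

lemma powr_tangent:
  fixes s t p :: real
  assumes "1 \<le> p" "0 \<le> s" "0 < t"
  shows "t powr p + p * t powr (p - 1) * (s - t) \<le> s powr p"
proof (cases "s = 0")
  case True
  have "t powr p = t * t powr (p - 1)" using assms by (simp add: powr_mult_base)
  then have "t powr p + p * t powr (p - 1) * (s - t) = (1 - p) * t powr p"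
    using True by (simp add: algebra_simps)
  also have "\<dots> \<le> 0" using assms by (simp add: mult_nonpos_nonneg)
  finally show ?thesis using True by simp
next
  case False
  have "p * t powr (p - 1) * (s - t) \<le> s powr p - t powr p"
    using assms False
    by (intro convex_on_imp_above_tangent[OF powr_convex])
       (auto intro!: derivative_eq_intros simp: interior_open)
  then show ?thesis by simp
qed

lemma abs_powr_tangent:
  fixes s t p :: real
  assumes "1 < p"
  shows "\<bar>t\<bar> powr p + p * signed_powr (p - 1) t * (s - t) \<le> \<bar>s\<bar> powr p"
proof -
  have pos: "\<bar>t\<bar> powr p + p * signed_powr (p - 1) t * (s - t) \<le> \<bar>s\<bar> powr p" if "0 < t" for s t :: real
  proof -
    have "t powr p + p * t powr (p - 1) * (s - t) \<le> t powr p + p * t powr (p - 1) * (\<bar>s\<bar> - t)"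
      using assms by (intro add_left_mono mult_left_mono) auto
    also have "\<dots> \<le> \<bar>s\<bar> powr p" using assms that by (intro powr_tangent) auto
    finally show ?thesis using that by (simp add: signed_powr_nonneg)
  qed
  consider "t = 0" | "0 < t" | "t < 0" by linarith
  then show ?thesis
  proof cases
    case 3
    have "p * signed_powr (p - 1) (-t) * (- s - - t) = p * signed_powr (p - 1) t * (s - t)"
      by (simp add: algebra_simps)
    then show ?thesis using pos[of "-t" "-s"] 3 by simp
  qed (use pos in \<open>auto simp: signed_powr_def\<close>)
qed

lemma integrable_lebesgue_on_bounded:
  fixes f :: "'a::euclidean_space \<Rightarrow> real"
  assumes "K \<in> lmeasurable" "f \<in> borel_measurable (lebesgue_on K)" "\<And>y. y \<in> K \<Longrightarrow> \<bar>f y\<bar> \<le> B"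
  shows "integrable (lebesgue_on K) f"
proof -
  interpret finite_measure "lebesgue_on K" by (rule finite_measure_lebesgue_on) fact
  show ?thesis using assms
    by (intro integrable_const_bound[where B=B] AE_I2) auto
qed

lemma integral_lebesgue_on_less:
  fixes f g :: "'a::euclidean_space \<Rightarrow> real"
  assumes "K \<in> lmeasurable" "0 < measure lebesgue K"
    and "integrable (lebesgue_on K) f" "integrable (lebesgue_on K) g"
    and "\<And>y. y \<in> K \<Longrightarrow> f y < g y"
  shows "integral\<^sup>L (lebesgue_on K) f < integral\<^sup>L (lebesgue_on K) g"
proof -
  interpret finite_measure "lebesgue_on K" by (rule finite_measure_lebesgue_on) fact
  have "emeasure lebesgue K \<noteq> 0" using assms(2) by (auto simp: measure_def)
  then have "emeasure (lebesgue_on K) K \<noteq> 0"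
    using assms(1) by (simp add: emeasure_restrict_space fmeasurableD)
  then show ?thesis using assms
    by (intro integral_less_AE_space AE_I2) auto
qed

lemma integral_lebesgue_on_const:
  assumes "K \<in> lmeasurable"
  shows "integral\<^sup>L (lebesgue_on K) (\<lambda>_. c::real) = c * measure lebesgue K"
  using assms by (simp add: measure_restrict_space fmeasurableD)

section \<open>Existence, uniqueness and a one-sided Euler inequality for minimizers of the
  p-energy\<close>

text \<open>A relation instead of a description operator: it can be used before uniqueness is known
  and passes directly to \<open>- v\<close>. The root in the norm is dropped because it does not
  affect minimality.\<close>

definition Lp_centre :: "real \<Rightarrow> 'a::euclidean_space set \<Rightarrow> ('a \<Rightarrow> real) \<Rightarrow> real \<Rightarrow> bool" where
  "Lp_centre p K v m \<longleftrightarrow> (\<forall>c. integral\<^sup>L (lebesgue_on K) (\<lambda>y. \<bar>v y - m\<bar> powr p)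
      \<le> integral\<^sup>L (lebesgue_on K) (\<lambda>y. \<bar>v y - c\<bar> powr p))"

lemma Lp_centre_uminus: "Lp_centre p K v m \<Longrightarrow> Lp_centre p K (\<lambda>y. - v y) (- m)"
  unfolding Lp_centre_def
proof
  fix c assume *: "\<forall>c. integral\<^sup>L (lebesgue_on K) (\<lambda>y. \<bar>v y - m\<bar> powr p)
      \<le> integral\<^sup>L (lebesgue_on K) (\<lambda>y. \<bar>v y - c\<bar> powr p)"
  have "\<bar>- v y - - m\<bar> = \<bar>v y - m\<bar>" "\<bar>- v y - c\<bar> = \<bar>v y - - c\<bar>" for y by auto
  then show "integral\<^sup>L (lebesgue_on K) (\<lambda>y. \<bar>- v y - - m\<bar> powr p)
      \<le> integral\<^sup>L (lebesgue_on K) (\<lambda>y. \<bar>- v y - c\<bar> powr p)" using *[rule_format, of "-c"] by simp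
qed

context
  fixes K :: "'a::euclidean_space set" and v :: "'a \<Rightarrow> real" and B p :: real
  assumes K: "K \<in> lmeasurable" "0 < measure lebesgue K"
    and v [measurable]: "v \<in> borel_measurable (lebesgue_on K)"
    and B: "\<And>y. y \<in> K \<Longrightarrow> \<bar>v y\<bar> \<le> B"
    and p: "1 < p"
begin

lemma integrable_abs_powr_diff: "integrable (lebesgue_on K) (\<lambda>y. \<bar>v y - c\<bar> powr p)"
proof (rule integrable_lebesgue_on_bounded[OF K(1)])
  show "\<bar>\<bar>v y - c\<bar> powr p\<bar> \<le> (B + \<bar>c\<bar>) powr p" if "y \<in> K" for y
    using B[OF that] p by (auto intro!: powr_mono2)
qed measurable

lemma integrable_signed_powr_diff: "integrable (lebesgue_on K) (\<lambda>y. signed_powr (p - 1) (v y - c))"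
proof (rule integrable_lebesgue_on_bounded[OF K(1)])
  show "\<bar>signed_powr (p - 1) (v y - c)\<bar> \<le> (B + \<bar>c\<bar>) powr (p - 1)" if "y \<in> K" for y
    using B[OF that] p by (auto intro!: powr_mono2 simp: abs_signed_powr)
qed measurable

text \<open>Integrating the tangent inequality at \<open>v - (m - t)\<close> shows that, were the integral negative,
  lowering \<open>m\<close> to \<open>m - t\<close> would decrease the \<open>p\<close>-energy.\<close>
lemma Lp_centre_upper:
  assumes "Lp_centre p K v m" "0 < t"
  shows "0 \<le> integral\<^sup>L (lebesgue_on K) (\<lambda>y. signed_powr (p - 1) (v y - (m - t)))"
proof -
  let ?I = "integral\<^sup>L (lebesgue_on K)"
  have int: "integrable (lebesgue_on K) (\<lambda>y. \<bar>v y - (m - t)\<bar> powr p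
      + (- p * t) * signed_powr (p - 1) (v y - (m - t)))"
    using integrable_abs_powr_diff integrable_signed_powr_diff
    by (intro Bochner_Integration.integrable_add Bochner_Integration.integrable_mult_right)
  have "?I (\<lambda>y. \<bar>v y - (m - t)\<bar> powr p) + (- p * t) * ?I (\<lambda>y. signed_powr (p - 1) (v y - (m - t)))
     = ?I (\<lambda>y. \<bar>v y - (m - t)\<bar> powr p + (- p * t) * signed_powr (p - 1) (v y - (m - t)))"
    using integrable_abs_powr_diff integrable_signed_powr_diff
    by (subst Bochner_Integration.integral_add) (auto intro!: Bochner_Integration.integrable_mult_right)
  also have "\<dots> \<le> ?I (\<lambda>y. \<bar>v y - m\<bar> powr p)"
  proof (rule integral_mono[OF int integrable_abs_powr_diff])
    fix y
    show "\<bar>v y - (m - t)\<bar> powr p + (- p * t) * signed_powr (p - 1) (v y - (m - t)) \<le> \<bar>v y - m\<bar> powr p"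
      using abs_powr_tangent[OF p, of "v y - (m - t)" "v y - m"] by (simp add: algebra_simps)
  qed
  also have "\<dots> \<le> ?I (\<lambda>y. \<bar>v y - (m - t)\<bar> powr p)"
    using assms(1) by (simp add: Lp_centre_def)
  finally have "0 \<le> (p * t) * ?I (\<lambda>y. signed_powr (p - 1) (v y - (m - t)))" by simp
  moreover have "0 < p * t" using p assms(2) by simp
  ultimately show ?thesis by (simp only: zero_le_mult_iff) linarith
qed

text \<open>Direct method: the energy is continuous in \<open>c\<close> by dominated convergence, so
  it has a minimum on the compact range of possible values of \<open>v\<close>.\<close>

lemma Lp_centre_exists: "\<exists>m. Lp_centre p K v m"
proof -
  define F where "F c = integral\<^sup>L (lebesgue_on K) (\<lambda>y. \<bar>v y - c\<bar> powr p)" for c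
  have B0: "0 \<le> B"
  proof -
    have "K \<noteq> {}" using K(2) by auto
    then show ?thesis using B by force
  qed
  have "continuous_on UNIV F"
  proof (rule continuous_at_imp_continuous_on, rule ballI)
    fix c :: real
    have "(\<lambda>n. F (d n)) \<longlonglongrightarrow> F c" if d: "d \<longlonglongrightarrow> c" for d
    proof -
      obtain D where D: "\<And>n. \<bar>d n\<bar> \<le> D"
        using Bseq_def convergent_imp_Bseq convergentI[OF d] by (metis real_norm_def)
      show ?thesis unfolding F_def
      proof (rule integral_dominated_convergence[where w = "\<lambda>_. (B + D) powr p"])
        show "AE y in lebesgue_on K. (\<lambda>n. \<bar>v y - d n\<bar> powr p) \<longlonglongrightarrow> \<bar>v y - c\<bar> powr p"
          using p by (intro AE_I2 tendsto_powr' tendsto_intros d) auto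
        show "AE y in lebesgue_on K. norm (\<bar>v y - d n\<bar> powr p) \<le> (B + D) powr p" for n
        proof (rule AE_I2)
          fix y assume "y \<in> space (lebesgue_on K)"
          then show "norm (\<bar>v y - d n\<bar> powr p) \<le> (B + D) powr p"
            using B[of y] D[of n] p by (auto intro!: powr_mono2)
        qed
        show "integrable (lebesgue_on K) (\<lambda>_. (B + D) powr p)"
          by (rule integrable_lebesgue_on_bounded[OF K(1)]) auto
      qed measurable
    qed
    then show "isCont F c" by (simp add: continuous_at_sequentially o_def)
  qed
  then obtain m where m: "m \<in> {-B..B}" "\<And>c. c \<in> {-B..B} \<Longrightarrow> F m \<le> F c"
    using continuous_attains_inf[of "{-B..B}" F] B0 continuous_on_subset by force
  have "F m \<le> F c" for c
  proof -
    \<comment> \<open>The projection of \<open>c\<close> to the interval from \<open>-B\<close> to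
      \<open>B\<close>. It is at least as close as \<open>c\<close> to every value of
      \<open>v\<close> on \<open>K\<close>, hence has no larger energy.\<close>
    define d where "d = max (-B) (min B c)"
    have "F m \<le> F d" by (rule m(2)) (use B0 in \<open>auto simp: d_def\<close>)
    also have "\<dots> \<le> F c" unfolding F_def
      by (intro integral_mono integrable_abs_powr_diff powr_mono2)
         (use p B in \<open>force simp: d_def max_def min_def split: if_splits\<close>)+
    finally show ?thesis .
  qed
  then show ?thesis by (auto simp: Lp_centre_def F_def)
qed

end

lemma Lp_centre_unique:
  fixes K :: "'a::euclidean_space set"
  assumes K: "K \<in> lmeasurable" "0 < measure lebesgue K"
    and v [measurable]: "v \<in> borel_measurable (lebesgue_on K)"
    and B: "\<And>y. y \<in> K \<Longrightarrow> \<bar>v y\<bar> \<le> B"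
    and p: "1 < p" and "Lp_centre p K v m" "Lp_centre p K v m'"
  shows "m = m'"
proof -
  have False if m: "Lp_centre p K v m" "Lp_centre p K v m'" "m < m'" for m m'
  proof -
    \<comment> \<open>A quarter of the gap keeps \<open>m + t\<close> below \<open>m' - t\<close>.
      The one-sided inequality, for \<open>- v\<close> at \<open>m\<close> and for \<open>v\<close>
      at \<open>m'\<close>, gives integrals of opposite sign at these two levels, against strict
      monotonicity of the odd power. No differentiation under the integral is required.\<close>
    define t where "t = (m' - m) / 4"
    let ?I = "integral\<^sup>L (lebesgue_on K)"
    have "0 < t" using m by (simp add: t_def)
    have "0 \<le> ?I (\<lambda>y. signed_powr (p - 1) (- v y - (- m - t)))"
      using B by (intro Lp_centre_upper[OF K _ _ p Lp_centre_uminus[OF m(1)] \<open>0 < t\<close>]) auto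
    also have "(\<lambda>y. signed_powr (p - 1) (- v y - (- m - t))) = (\<lambda>y. - signed_powr (p - 1) (v y - (m + t)))"
      by (subst signed_powr_minus[symmetric]) (simp add: algebra_simps)
    finally have "?I (\<lambda>y. signed_powr (p - 1) (v y - (m + t))) \<le> 0" by simp
    moreover have "0 \<le> ?I (\<lambda>y. signed_powr (p - 1) (v y - (m' - t)))"
      by (rule Lp_centre_upper[OF K v B p m(2) \<open>0 < t\<close>])
    moreover have "?I (\<lambda>y. signed_powr (p - 1) (v y - (m' - t))) < ?I (\<lambda>y. signed_powr (p - 1) (v y - (m + t)))"
      by (intro integral_lebesgue_on_less K integrable_signed_powr_diff[OF K v B p] signed_powr_strict_mono)
         (use p m in \<open>auto simp: t_def field_simps\<close>)
    ultimately show False by linarith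
  qed
  then show ?thesis using assms(6,7) by (metis linorder_neqE_linordered_idom)
qed

text \<open>The \<open>THE\<close> in \<open>natural_p_mean\<close> yields information only once a
  unique minimizer is known; taking the root \<open>1/p\<close> is strictly monotone, so the norm
  and the energy have the same minimizers.\<close>

lemma natural_p_mean_Lp_centre:
  fixes \<phi> :: "real ^ 3 \<Rightarrow> real" and x :: "real ^ 3" and \<epsilon> :: real
  defines "K \<equiv> closure (heis_ball x \<epsilon>)"
  assumes K: "K \<in> lmeasurable" "0 < measure lebesgue K"
    and v: "\<phi> \<in> borel_measurable (lebesgue_on K)"
    and B: "\<And>y. y \<in> K \<Longrightarrow> \<bar>\<phi> y\<bar> \<le> B"
    and p: "1 < p"
  shows "Lp_centre p K \<phi> (natural_p_mean p \<phi> \<epsilon> x)"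
proof -
  have eq: "Lp_norm_on p K f = (integral\<^sup>L (lebesgue_on K) (\<lambda>y. \<bar>f y\<bar> powr p)) powr (1/p)" for f
    using K(1) by (simp add: Lp_norm_on_def set_lebesgue_integral_def integral_restrict_space fmeasurableD)
  have le: "a powr (1/p) \<le> b powr (1/p) \<longleftrightarrow> a \<le> b" if "0 \<le> a" "0 \<le> b" for a b
    using that p powr_less_mono2[of "1/p" b a] powr_mono2[of "1/p" a b] by fastforce
  have *: "(\<forall>c. Lp_norm_on p K (\<lambda>y. \<phi> y - m) \<le> Lp_norm_on p K (\<lambda>y. \<phi> y - c)) \<longleftrightarrow> Lp_centre p K \<phi> m" for m
    unfolding eq Lp_centre_def by (subst le) auto
  have "\<exists>!m. Lp_centre p K \<phi> m"
    using Lp_centre_exists[OF K v B p] Lp_centre_unique[OF K v B p] by blast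
  from theI'[OF this] show ?thesis
    unfolding natural_p_mean_def K_def[symmetric] * .
qed

subsection \<open>Odd functions of an exponential profile\<close>

text \<open>The second derivative of \<open>cosh\<close> is at least \<open>1\<close>; monotonicity
  is applied twice, to \<open>sinh t - t\<close> and then to \<open>cosh t - t\<^sup>2 / 2\<close>.
  The quadratic term later becomes the gain over the remainder.\<close>

lemma cosh_lower_quadratic: "1 + t\<^sup>2 / 2 \<le> cosh (t::real)"
proof -
  have *: "1 + t\<^sup>2 / 2 \<le> cosh t" if "0 \<le> t" for t :: real
  proof -
    define f g where "f t = sinh t - t" and "g t = cosh t - t\<^sup>2 / 2" for t :: real
    have f: "f 0 \<le> f s" if "0 \<le> s" for s
    proof (rule DERIV_nonneg_imp_nondecreasing[OF that])
      fix x :: real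
      have "(f has_real_derivative cosh x - 1) (at x)"
        unfolding f_def by (auto intro!: derivative_eq_intros)
      then show "\<exists>y. (f has_real_derivative y) (at x) \<and> 0 \<le> y"
        using cosh_real_ge_1[of x] by auto
    qed
    have "g 0 \<le> g t"
    proof (rule DERIV_nonneg_imp_nondecreasing[OF that])
      fix s :: real assume s: "0 \<le> s" "s \<le> t"
      have "(g has_real_derivative f s) (at s)"
        unfolding f_def g_def by (auto intro!: derivative_eq_intros)
      moreover have "0 \<le> f s" using f[OF s(1)] by (simp add: f_def)
      ultimately show "\<exists>y. (g has_real_derivative y) (at s) \<and> 0 \<le> y" by blast
    qed
    then show ?thesis by (simp add: g_def)
  qed
  show ?thesis using *[of t] *[of "-t"] by (cases "0 \<le> t") auto
qed

text \<open>For negative \<open>t\<close> the left side is a difference of values of the power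
  \<open>p - 1\<close> at \<open>s\<close> and \<open>-t\<close>, and the tangent at
  \<open>s\<close> lies below this convex power. Replacing the slope at \<open>s\<close> by the
  slope at \<open>c\<close> is harmless: the two last assumptions put \<open>s\<close> on the side
  of \<open>c\<close> that the sign of \<open>s + t\<close> calls for.\<close>

lemma signed_powr_pair:
  fixes s t c p :: real
  assumes p: "2 \<le> p" and c: "0 < c" and st: "t \<le> s" "0 < s"
    and "s + t \<le> 0 \<Longrightarrow> c \<le> s" and "0 < s + t \<Longrightarrow> s \<le> c"
  shows "signed_powr (p - 1) s + signed_powr (p - 1) t \<le> (p - 1) * c powr (p - 2) * (s + t)"
proof -
  have tangent: "signed_powr (p - 1) s + signed_powr (p - 1) t \<le> (p - 1) * s powr (p - 2) * (s + t)"
  proof (cases "0 \<le> t")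
    case True
    have "t powr (p - 1) = t * t powr (p - 2)" "s powr (p - 1) = s * s powr (p - 2)"
      using powr_mult_base[of t "p - 2"] powr_mult_base[of s "p - 2"] st True by (auto simp: add.commute)
    moreover have "t * t powr (p - 2) \<le> t * s powr (p - 2)"
      using True st p by (intro mult_left_mono powr_mono2) auto
    ultimately have "s powr (p - 1) + t powr (p - 1) \<le> 1 * (s powr (p - 2) * (s + t))"
      by (simp add: algebra_simps)
    also have "\<dots> \<le> (p - 1) * (s powr (p - 2) * (s + t))"
      using p st True by (intro mult_right_mono) auto
    finally show ?thesis using True st by (simp add: signed_powr_nonneg mult.assoc)
  next
    case False
    then have "signed_powr (p - 1) t = - ((-t) powr (p - 1))"
      using signed_powr_minus[of "p - 1" "-t"] by (simp add: signed_powr_nonneg del: signed_powr_minus)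
    moreover have "s powr (p - 1) + (p - 1) * s powr (p - 1 - 1) * (- t - s) \<le> (- t) powr (p - 1)"
      using p st False by (intro powr_tangent) auto
    ultimately show ?thesis using st by (simp add: signed_powr_nonneg algebra_simps)
  qed
  have "s powr (p - 2) * (s + t) \<le> c powr (p - 2) * (s + t)"
  proof (cases "s + t \<le> 0")
    case True
    then show ?thesis using assms by (intro mult_right_mono_neg powr_mono2) auto
  next
    case False
    then show ?thesis using assms by (intro mult_right_mono powr_mono2) auto
  qed
  then have "(p - 1) * (s powr (p - 2) * (s + t)) \<le> (p - 1) * (c powr (p - 2) * (s + t))"
    using p by (intro mult_left_mono) auto
  with tangent show ?thesis by (simp add: mult.assoc)
qed

text \<open>As in Chebyshev's sum inequality: \<open>\<gamma>\<close> is the derivative of the signed power at the point where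
  the symmetrized profile, which decreases in \<open>\<bar>l\<bar>\<close>, changes sign.\<close>
lemma signed_powr_exp_pair:
  fixes b q p :: real
  assumes b: "0 < b" and q: "0 < q" and p: "2 \<le> p"
  obtains \<gamma> where "0 < \<gamma>"
    "\<And>l. signed_powr (p - 1) (1 - exp (- (b * (l + q)))) + signed_powr (p - 1) (1 - exp (- (b * (- l + q))))
      \<le> \<gamma> * (2 - 2 * exp (- (b * q)) * cosh (b * l))"
proof -
  define f where "f l = 1 - exp (- (b * (l + q)))" for l
  \<comment> \<open>The zero of \<open>f l + f (- l)\<close>: it solves
    \<open>exp (- (b * q)) * cosh (b * l) = 1\<close>, and \<open>exp (b * q)\<close> exceeds
    \<open>1\<close> because \<open>q\<close> is positive.\<close>
  define l0 where "l0 = arcosh (exp (b * q)) / b"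
  define \<gamma> where "\<gamma> = (p - 1) * f l0 powr (p - 2)"
  have bq: "1 < exp (b * q)" using b q by simp
  have l0: "0 \<le> l0" using b bq by (simp add: l0_def)
  have cosh_l0: "cosh (b * l0) = exp (b * q)" using b bq by (simp add: l0_def)
  have f_mono: "f l \<le> f l'" if "l \<le> l'" for l l'
    using that b by (simp add: f_def)
  have "0 < f 0" using b q by (simp add: f_def)
  have f_pos: "0 < f l" if "0 \<le> l" for l
    using f_mono[OF that] \<open>0 < f 0\<close> by linarith
  have f_sum: "f l + f (- l) = 2 - 2 * exp (- (b * q)) * cosh (b * l)" for l
    by (simp add: f_def cosh_field_def algebra_simps exp_add[symmetric] add_divide_distrib)
  have main: "signed_powr (p - 1) (f l) + signed_powr (p - 1) (f (- l)) \<le> \<gamma> * (f l + f (- l))" if "0 \<le> l" for l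
    unfolding \<gamma>_def
  proof (rule signed_powr_pair[OF p f_pos[OF l0]])
    have iff: "f l + f (- l) \<le> 0 \<longleftrightarrow> cosh (b * l0) \<le> cosh (b * l)"
      unfolding f_sum cosh_l0 by (simp add: exp_minus field_simps)
    then have iff': "f l + f (- l) \<le> 0 \<longleftrightarrow> l0 \<le> l"
      using b l0 that by (simp add: cosh_real_nonneg_le_iff)
    show "f l0 \<le> f l" if "f l + f (- l) \<le> 0" using that iff' by (auto intro: f_mono)
    show "f l \<le> f l0" if "0 < f l + f (- l)" using that iff' by (auto intro: f_mono)
    show "f (- l) \<le> f l" "0 < f l" using that by (auto intro: f_mono f_pos)
  qed
  show thesis
  proof
    show "0 < \<gamma>" using p f_pos[OF l0] by (simp add: \<gamma>_def)
    show "signed_powr (p - 1) (1 - exp (- (b * (l + q)))) + signed_powr (p - 1) (1 - exp (- (b * (- l + q))))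
      \<le> \<gamma> * (2 - 2 * exp (- (b * q)) * cosh (b * l))" for l
      using main[of l] main[of "- l"] unfolding f_sum[symmetric]
      by (cases "0 \<le> l") (auto simp: f_def add.commute)
  qed
qed

lemma integral_lebesgue_on_point_reflect:
  fixes f :: "'a::euclidean_space \<Rightarrow> real"
  assumes K: "K \<in> sets lebesgue" and sym: "\<And>y. y \<in> K \<Longrightarrow> c - y \<in> K"
    and f: "f \<in> borel_measurable (lebesgue_on K)"
  shows "integral\<^sup>L (lebesgue_on K) (\<lambda>y. f (c - y)) = integral\<^sup>L (lebesgue_on K) f"
proof -
  define F where "F y = indicator K y *\<^sub>R f y" for y
  have F: "F \<in> borel_measurable lebesgue"
    using f K unfolding F_def by (simp add: borel_measurable_restrict_space_iff)
  \<comment> \<open>The reflection is written as a coordinatewise scaling by \<open>-1\<close> to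
    fit the affine change of variables, whose density is then the absolute value of a product of
    factors \<open>-1\<close>, that is \<open>1\<close>.\<close>
  have T: "c + (\<Sum>j\<in>Basis. (- 1 * (x \<bullet> j)) *\<^sub>R j) = c - x" for x :: 'a
    by (simp add: sum_negf euclidean_representation)
  have T_meas: "(\<lambda>x. c - x) \<in> lebesgue \<rightarrow>\<^sub>M lebesgue"
    using lebesgue_affine_measurable[of "\<lambda>_. -1" c] unfolding T by simp
  have lebesgue_eq: "lebesgue = distr lebesgue lebesgue (\<lambda>x. c - x)"
    using lebesgue_affine_euclidean[of "\<lambda>_::'a. -1" c] unfolding T by (simp add: density_1)
  have "integral\<^sup>L (lebesgue_on K) f = integral\<^sup>L lebesgue F"
    using K by (simp add: integral_restrict_space F_def[abs_def])
  also have "\<dots> = integral\<^sup>L (distr lebesgue lebesgue (\<lambda>x. c - x)) F"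
    using lebesgue_eq by simp
  also have "\<dots> = integral\<^sup>L lebesgue (\<lambda>x. F (c - x))"
    by (rule integral_distr[OF T_meas F])
  also have "(\<lambda>x. F (c - x)) = (\<lambda>x. indicator K x *\<^sub>R f (c - x))"
    using sym sym[of "c - _"] by (force simp: F_def indicator_def)
  also have "integral\<^sup>L lebesgue \<dots> = integral\<^sup>L (lebesgue_on K) (\<lambda>y. f (c - y))"
    using K by (simp add: integral_restrict_space)
  finally show ?thesis by simp
qed

subsection \<open>The Koranyi gauge\<close>

text \<open>Being a polynomial in the coordinates, the fourth power has an exact expansion under the
  group law, and comparisons of gauges avoid roots.\<close>

definition gauge_pow4 :: "real ^ 3 \<Rightarrow> real" where
  "gauge_pow4 x = ((x $ 1)\<^sup>2 + (x $ 2)\<^sup>2)\<^sup>2 + 16 * (x $ 3)\<^sup>2"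

lemma gauge_pow4_nonneg [simp]: "0 \<le> gauge_pow4 x"
  by (simp add: gauge_pow4_def)

lemma koranyi_gauge_eq: "koranyi_gauge x = root 4 (gauge_pow4 x)"
  by (simp add: koranyi_gauge_def gauge_pow4_def)

lemma koranyi_gauge_nonneg [simp]: "0 \<le> koranyi_gauge x"
  by (simp add: koranyi_gauge_eq)

lemma koranyi_gauge_pow4: "koranyi_gauge x ^ 4 = gauge_pow4 x"
  by (simp add: koranyi_gauge_eq)

lemma koranyi_gauge_less_iff: "0 \<le> r \<Longrightarrow> koranyi_gauge x < r \<longleftrightarrow> gauge_pow4 x < r ^ 4"
  using power_mono_iff[of r "koranyi_gauge x" 4] by (simp add: koranyi_gauge_pow4) linarith

lemma koranyi_gauge_le_iff: "0 \<le> r \<Longrightarrow> koranyi_gauge x \<le> r \<longleftrightarrow> gauge_pow4 x \<le> r ^ 4"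
  unfolding koranyi_gauge_pow4[symmetric] by simp

lemma koranyi_gauge_minus [simp]: "koranyi_gauge (- x) = koranyi_gauge x"
  by (simp add: koranyi_gauge_def)

lemma heis_mult_nth [simp]:
  "heis_mult x y $ 1 = x $ 1 + y $ 1"
  "heis_mult x y $ 2 = x $ 2 + y $ 2"
  "heis_mult x y $ 3 = x $ 3 + y $ 3 + (x $ 1 * y $ 2 - x $ 2 * y $ 1) / 2"
  by (simp_all add: heis_mult_def)

text \<open>Cygan's argument: \<open>\<bar>x\<bar>\<^sup>2\<close> is the modulus of the complex number \<open>x\<^sub>1\<^sup>2 + x\<^sub>2\<^sup>2 + 4 i x\<^sub>3\<close>.\<close>
lemma koranyi_gauge_triangle: "koranyi_gauge (heis_mult x y) \<le> koranyi_gauge x + koranyi_gauge y"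
proof -
  define \<zeta> where "\<zeta> x = Complex ((x $ 1)\<^sup>2 + (x $ 2)\<^sup>2) (4 * x $ 3)" for x :: "real ^ 3"
  define w where "w x = Complex (x $ 1) (x $ 2)" for x :: "real ^ 3"
  have norm_\<zeta>: "cmod (\<zeta> x) = (koranyi_gauge x)\<^sup>2" for x
  proof -
    have "(cmod (\<zeta> x))\<^sup>2 = gauge_pow4 x"
      by (simp add: \<zeta>_def cmod_power2 gauge_pow4_def power_mult_distrib)
    also have "\<dots> = ((koranyi_gauge x)\<^sup>2)\<^sup>2"
      by (simp add: koranyi_gauge_pow4 flip: power_mult)
    finally show ?thesis by (rule power2_eq_imp_eq) auto
  qed
  have norm_w: "cmod (w x) \<le> koranyi_gauge x" for x
  proof -
    have "(cmod (w x))\<^sup>2 = Re (\<zeta> x)" by (simp add: w_def \<zeta>_def cmod_power2)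
    also have "\<dots> \<le> (koranyi_gauge x)\<^sup>2" using complex_Re_le_cmod[of "\<zeta> x"] by (simp add: norm_\<zeta>)
    finally show ?thesis by (rule power2_le_imp_le) simp
  qed
  \<comment> \<open>The imaginary part of \<open>cnj (w x) * w y\<close> is the symplectic form in
    the group law. Its coefficient \<open>1/2\<close> times the \<open>4\<close> in
    \<open>\<zeta>\<close> gives the same factor \<open>2\<close> as the cross term of the squared
    modulus of \<open>w x + w y\<close>.\<close>
  have "\<zeta> (heis_mult x y) = \<zeta> x + \<zeta> y + 2 * (cnj (w x) * w y)"
    by (simp add: \<zeta>_def w_def complex_eq_iff power2_eq_square field_simps)
  then have "(koranyi_gauge (heis_mult x y))\<^sup>2 = cmod (\<zeta> x + \<zeta> y + 2 * (cnj (w x) * w y))"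
    by (simp add: norm_\<zeta>[symmetric])
  also have "\<dots> \<le> cmod (\<zeta> x) + cmod (\<zeta> y) + cmod (2 * (cnj (w x) * w y))"
    by (intro order_trans[OF norm_triangle_ineq] add_right_mono norm_triangle_ineq)
  also have "\<dots> = cmod (\<zeta> x) + cmod (\<zeta> y) + 2 * (cmod (w x) * cmod (w y))"
    by (simp add: norm_mult)
  also have "\<dots> \<le> (koranyi_gauge x)\<^sup>2 + (koranyi_gauge y)\<^sup>2 + 2 * (koranyi_gauge x * koranyi_gauge y)"
    unfolding norm_\<zeta> by (intro add_left_mono mult_left_mono mult_mono norm_w) auto
  also have "\<dots> = (koranyi_gauge x + koranyi_gauge y)\<^sup>2" by (simp add: power2_sum)
  finally show ?thesis by (rule power2_le_imp_le) simp
qed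

lemma heis_dist_triangle: "heis_dist x z \<le> heis_dist x y + heis_dist y z"
proof -
  have "heis_mult (heis_inv x) z = heis_mult (heis_mult (heis_inv x) y) (heis_mult (heis_inv y) z)"
    by (metis heis_mult_0(1) heis_mult_assoc heis_mult_inv(2))
  then show ?thesis by (simp add: heis_dist_def koranyi_gauge_triangle)
qed

lemma heis_dist_commute: "heis_dist x y = heis_dist y x"
proof -
  have "heis_mult (heis_inv x) y = - heis_mult (heis_inv y) x"
    by (simp add: vec_eq_iff forall_3 heis_inv_def field_simps)
  then show ?thesis by (simp add: heis_dist_def)
qed

lemma heis_dist_nonneg [simp]: "0 \<le> heis_dist x y"
  by (simp add: heis_dist_def)

lemma heis_dist_refl [simp]: "heis_dist x x = 0"
  by (simp add: heis_dist_def heis_mult_inv koranyi_gauge_def)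

section \<open>Continuity of the group operations, and compactness and volume of balls\<close>

lemma continuous_on_heis_mult [continuous_intros]:
  assumes "continuous_on S f" "continuous_on S g"
  shows "continuous_on S (\<lambda>x. heis_mult (f x) (g x))"
proof -
  have eq: "heis_mult a b = a + b + ((a $ 1 * b $ 2 - a $ 2 * b $ 1) / 2) *\<^sub>R axis 3 1" for a b
    by (simp add: vec_eq_iff forall_3 axis_def)
  show ?thesis unfolding eq by (intro continuous_intros assms) simp
qed

lemma continuous_on_gauge_pow4 [continuous_intros]:
  "continuous_on S f \<Longrightarrow> continuous_on S (\<lambda>x. gauge_pow4 (f x))"
  unfolding gauge_pow4_def by (intro continuous_intros)

lemma continuous_on_heis_dist [continuous_intros]:
  "continuous_on S f \<Longrightarrow> continuous_on S (\<lambda>x. heis_dist c (f x))"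
  unfolding heis_dist_def koranyi_gauge_eq by (intro continuous_intros)

lemma heis_dist_less_iff:
  "0 \<le> r \<Longrightarrow> heis_dist x y < r \<longleftrightarrow> gauge_pow4 (heis_mult (heis_inv x) y) < r ^ 4"
  by (simp add: heis_dist_def koranyi_gauge_less_iff)

lemma heis_dist_le_iff:
  "0 \<le> r \<Longrightarrow> heis_dist x y \<le> r \<longleftrightarrow> gauge_pow4 (heis_mult (heis_inv x) y) \<le> r ^ 4"
  by (simp add: heis_dist_def koranyi_gauge_le_iff)

lemma heis_mult_inv_mult [simp]: "heis_mult (heis_inv x) (heis_mult x h) = h"
  by (metis heis_mult_0(1) heis_mult_assoc heis_mult_inv(1))

lemma heis_mult_mult_inv [simp]: "heis_mult x (heis_mult (heis_inv x) y) = y"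
  by (metis heis_mult_0(1) heis_mult_assoc heis_mult_inv(2))

text \<open>Left translation is a Euclidean translation composed with a unipotent shear.\<close>
lemma
  assumes "B \<in> lmeasurable"
  shows lmeasurable_heis_mult_image: "heis_mult x ` B \<in> lmeasurable"
    and measure_heis_mult_image: "measure lebesgue (heis_mult x ` B) = measure lebesgue B"
proof -
  define f where "f h = (vector [h $ 1, h $ 2, h $ 3 + (x $ 1 * h $ 2 - x $ 2 * h $ 1) / 2] :: real ^ 3)" for h :: "real ^ 3"
  have "linear f"
    by (rule linearI) (simp_all add: f_def vec_eq_iff forall_3 field_simps)
  have "det (matrix f) = 1"
    by (simp add: det_3 matrix_def f_def axis_def)
  then have f: "f ` B \<in> lmeasurable" "measure lebesgue (f ` B) = measure lebesgue B"
    using measurable_linear_image[OF \<open>linear f\<close> assms] measure_linear_image[OF \<open>linear f\<close> assms] by simp_all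
  have "heis_mult x ` B = (+) x ` f ` B"
    unfolding image_image by (rule image_cong) (auto simp: f_def vec_eq_iff forall_3)
  then show "heis_mult x ` B \<in> lmeasurable" "measure lebesgue (heis_mult x ` B) = measure lebesgue B"
    using f by (simp_all add: measurable_translation measure_translation)
qed

lemma gauge_pow4_le_bounds:
  assumes "gauge_pow4 h \<le> \<epsilon> ^ 4"
  shows "(h $ 1)\<^sup>2 + (h $ 2)\<^sup>2 \<le> \<epsilon>\<^sup>2" "16 * (h $ 3)\<^sup>2 \<le> \<epsilon> ^ 4"
proof -
  have *: "((h $ 1)\<^sup>2 + (h $ 2)\<^sup>2)\<^sup>2 \<le> (\<epsilon>\<^sup>2)\<^sup>2"
    using assms unfolding gauge_pow4_def by (simp add: power_mult[symmetric]) (smt (verit) zero_le_power2)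
  show "(h $ 1)\<^sup>2 + (h $ 2)\<^sup>2 \<le> \<epsilon>\<^sup>2" using power2_le_imp_le[OF *] by simp
  show "16 * (h $ 3)\<^sup>2 \<le> \<epsilon> ^ 4" using assms zero_le_power2[of "(h $ 1)\<^sup>2 + (h $ 2)\<^sup>2"]
    unfolding gauge_pow4_def by linarith
qed

lemma gauge_pow4_le_abs_bounds:
  assumes "gauge_pow4 h \<le> \<epsilon> ^ 4" "0 \<le> \<epsilon>"
  shows "\<bar>h $ 1\<bar> \<le> \<epsilon>" "\<bar>h $ 2\<bar> \<le> \<epsilon>" "\<bar>h $ 3\<bar> \<le> \<epsilon>\<^sup>2 / 4"
proof -
  note * = gauge_pow4_le_bounds[OF assms(1)]
  have "(h $ 1)\<^sup>2 \<le> \<epsilon>\<^sup>2" "(h $ 2)\<^sup>2 \<le> \<epsilon>\<^sup>2"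
    using *(1) zero_le_power2[of "h $ 1"] zero_le_power2[of "h $ 2"] by linarith+
  then show "\<bar>h $ 1\<bar> \<le> \<epsilon>" "\<bar>h $ 2\<bar> \<le> \<epsilon>"
    using assms(2) by (simp_all add: power2_le_iff_abs_le)
  have "(h $ 3)\<^sup>2 \<le> (\<epsilon>\<^sup>2 / 4)\<^sup>2"
    using *(2) by (simp add: power_divide flip: power_mult)
  then show "\<bar>h $ 3\<bar> \<le> \<epsilon>\<^sup>2 / 4" by (simp add: power2_le_iff_abs_le)
qed

lemma closure_heis_ball_le: "y \<in> closure (heis_ball x \<epsilon>) \<Longrightarrow> heis_dist x y \<le> \<epsilon>"
proof -
  have "closed {y. heis_dist x y \<le> \<epsilon>}"
    by (intro closed_Collect_le continuous_intros)
  moreover have "heis_ball x \<epsilon> \<subseteq> {y. heis_dist x y \<le> \<epsilon>}" by (auto simp: heis_ball_def)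
  ultimately show "y \<in> closure (heis_ball x \<epsilon>) \<Longrightarrow> heis_dist x y \<le> \<epsilon>"
    using closure_minimal by blast
qed

lemma content_cbox_3:
  fixes a b :: "real ^ 3"
  assumes "\<And>i. a $ i \<le> b $ i"
  shows "measure lebesgue (cbox a b) = (b $ 1 - a $ 1) * (b $ 2 - a $ 2) * (b $ 3 - a $ 3)"
proof -
  have "cbox a b \<noteq> {}" using assms unfolding interval_ne_empty_cart by blast
  then have "measure lborel (cbox a b) = (\<Prod>i\<in>UNIV. b $ i - a $ i)" by (rule content_cbox_cart)
  also have "\<dots> = (b $ 1 - a $ 1) * (b $ 2 - a $ 2) * (b $ 3 - a $ 3)" unfolding UNIV_3 by (simp add: mult.assoc)
  finally show ?thesis by (simp add: measure_completion)
qed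

text \<open>The box has sides \<open>2 * \<epsilon>\<close>, \<open>2 * \<epsilon>\<close> and
  \<open>\<epsilon>\<^sup>2 / 2\<close>; its translate supplies both compactness and the volume
  bound \<open>2 * \<epsilon> ^ 4\<close>.\<close>

lemma closure_heis_ball_subset_box:
  assumes "0 \<le> \<epsilon>"
  defines "d \<equiv> vector [\<epsilon>, \<epsilon>, \<epsilon>\<^sup>2 / 4] :: real ^ 3"
  shows "closure (heis_ball x \<epsilon>) \<subseteq> heis_mult x ` cbox (- d) d"
proof
  fix y assume "y \<in> closure (heis_ball x \<epsilon>)"
  then have "gauge_pow4 (heis_mult (heis_inv x) y) \<le> \<epsilon> ^ 4"
    using closure_heis_ball_le heis_dist_le_iff assms(1) by blast
  from gauge_pow4_le_abs_bounds[OF this assms(1)]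
  have "heis_mult (heis_inv x) y \<in> cbox (- d) d"
    unfolding mem_box_cart forall_3 by (auto simp: d_def abs_le_iff simp del: heis_mult_nth)
  then show "y \<in> heis_mult x ` cbox (- d) d" by (metis heis_mult_mult_inv image_eqI)
qed

lemma compact_closure_heis_ball:
  assumes "0 \<le> \<epsilon>"
  shows "compact (closure (heis_ball x \<epsilon>))"
proof -
  have "compact (heis_mult x ` cbox a b)" for a b
    by (intro compact_continuous_image continuous_intros compact_cbox)
  then have "bounded (closure (heis_ball x \<epsilon>))"
    using closure_heis_ball_subset_box[OF assms] bounded_subset compact_imp_bounded by metis
  then show ?thesis by (simp add: compact_eq_bounded_closed)
qed

section \<open>Expansion of the fourth power of the gauge along small group increments\<close>

text \<open>The derivative at \<open>h = 0\<close> of \<open>gauge_pow4 (heis_mult x h)\<close>. The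
  coefficients are the two left-invariant horizontal derivatives and the vertical derivative of
  \<open>gauge_pow4\<close> at \<open>x\<close>.\<close>

definition gauge_differential :: "real ^ 3 \<Rightarrow> real ^ 3 \<Rightarrow> real" where
  "gauge_differential x h = (let r = (x $ 1)\<^sup>2 + (x $ 2)\<^sup>2 in
     (4 * r * x $ 1 - 16 * x $ 3 * x $ 2) * h $ 1 + (4 * r * x $ 2 + 16 * x $ 3 * x $ 1) * h $ 2
       + 32 * x $ 3 * h $ 3)"

lemma gauge_differential_minus [simp]: "gauge_differential x (- h) = - gauge_differential x h"
  by (simp add: gauge_differential_def Let_def algebra_simps)

lemma continuous_on_gauge_differential [continuous_intros]:
  "continuous_on S f \<Longrightarrow> continuous_on S (\<lambda>y. gauge_differential x (f y))"
  unfolding gauge_differential_def Let_def by (intro continuous_intros)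

text \<open>The scale of the terms of higher order in \<open>h\<close>. The weight is the squared
  horizontal radius and not the squared gauge: near the vertical axis the remainder must shrink
  together with the horizontal part of the differential, or the square of the differential could not
  dominate it.\<close>

definition gauge_remainder :: "real \<Rightarrow> real ^ 3 \<Rightarrow> real" where
  "gauge_remainder \<epsilon> x = ((x $ 1)\<^sup>2 + (x $ 2)\<^sup>2) * \<epsilon>\<^sup>2 + \<epsilon> ^ 4"

lemma gauge_remainder_ge: "\<epsilon> ^ 4 \<le> gauge_remainder \<epsilon> x"
  by (simp add: gauge_remainder_def)

lemma sum_squares_le_gauge_pow4: "((x $ 1)\<^sup>2 + (x $ 2)\<^sup>2)\<^sup>2 \<le> gauge_pow4 x"
  by (simp add: gauge_pow4_def)

lemma radius_le_gauge_pow4: "(x $ 1)\<^sup>2 + (x $ 2)\<^sup>2 \<le> gauge_pow4 x + 1"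
proof -
  have "r \<le> r\<^sup>2 + 1" for r :: real
    using zero_le_power2[of "2 * r - 1"] by (simp add: power2_eq_square algebra_simps)
  then show ?thesis using sum_squares_le_gauge_pow4[of x] by (smt (verit))
qed

lemma gauge_remainder_le:
  assumes "0 \<le> \<epsilon>" "\<epsilon> \<le> 1"
  shows "gauge_remainder \<epsilon> x \<le> (gauge_pow4 x + 2) * \<epsilon>\<^sup>2"
proof -
  have "((x $ 1)\<^sup>2 + (x $ 2)\<^sup>2) * \<epsilon>\<^sup>2 \<le> (gauge_pow4 x + 1) * \<epsilon>\<^sup>2"
    by (intro mult_right_mono radius_le_gauge_pow4) simp
  moreover have "\<epsilon> ^ 4 \<le> \<epsilon>\<^sup>2" using assms by (intro power_decreasing) auto
  ultimately show ?thesis by (simp add: gauge_remainder_def algebra_simps)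
qed

text \<open>The nonlinear part is exactly \<open>2 * (r * s) + (2 * d + s)\<^sup>2 + 16 * (h $ 3 + w
  / 2)\<^sup>2\<close>. Since \<open>d\<close> and \<open>w\<close> are the real and imaginary parts
  of one complex product, \<open>d\<^sup>2 + w\<^sup>2 = r * s\<close>, and both squares are
  controlled by \<open>r\<close> and \<open>\<epsilon>\<close>. The coefficients found,
  \<open>10\<close> and \<open>4\<close>, lie below \<open>18\<close>.\<close>

lemma gauge_pow4_mult_le:
  assumes "gauge_pow4 h \<le> \<epsilon> ^ 4"
  shows "gauge_pow4 (heis_mult x h) \<le> gauge_pow4 x + gauge_differential x h + 18 * gauge_remainder \<epsilon> x"
proof -
  define r where "r = (x $ 1)\<^sup>2 + (x $ 2)\<^sup>2"
  define s where "s = (h $ 1)\<^sup>2 + (h $ 2)\<^sup>2"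
  define d where "d = x $ 1 * h $ 1 + x $ 2 * h $ 2"
  define w where "w = x $ 1 * h $ 2 - x $ 2 * h $ 1"
  have s: "0 \<le> s" "s \<le> \<epsilon>\<^sup>2" and h3: "16 * (h $ 3)\<^sup>2 \<le> \<epsilon> ^ 4"
    using gauge_pow4_le_bounds[OF assms] by (simp_all add: s_def)
  have r: "0 \<le> r" by (simp add: r_def)
  have "d\<^sup>2 + w\<^sup>2 = r * s" by (simp add: d_def w_def r_def s_def power2_eq_square algebra_simps)
  also have "\<dots> \<le> r * \<epsilon>\<^sup>2" using s r by (intro mult_left_mono) auto
  finally have dw: "d\<^sup>2 + w\<^sup>2 \<le> r * \<epsilon>\<^sup>2" .
  have s2: "s\<^sup>2 \<le> \<epsilon> ^ 4" using power_mono[OF s(2,1), of 2] by (simp flip: power_mult)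
  have rs: "r * s \<le> r * \<epsilon>\<^sup>2" using s r by (intro mult_left_mono) auto
  have "gauge_pow4 (heis_mult x h) = gauge_pow4 x + gauge_differential x h
      + 2 * (r * s) + (2 * d + s)\<^sup>2 + 16 * (h $ 3 + w / 2)\<^sup>2"
    unfolding gauge_pow4_def gauge_differential_def Let_def heis_mult_nth
    by (simp add: r_def s_def d_def w_def power2_eq_square field_simps)
  moreover have "(2 * d + s)\<^sup>2 \<le> 8 * d\<^sup>2 + 2 * s\<^sup>2"
    using zero_le_power2[of "2 * d - s"] by (simp add: power2_eq_square algebra_simps)
  moreover have "16 * (h $ 3 + w / 2)\<^sup>2 \<le> 32 * (h $ 3)\<^sup>2 + 8 * w\<^sup>2"
    using zero_le_power2[of "h $ 3 - w / 2"] by (simp add: power2_eq_square algebra_simps)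
  ultimately have "gauge_pow4 (heis_mult x h) \<le> gauge_pow4 x + gauge_differential x h
      + 2 * (r * \<epsilon>\<^sup>2) + 8 * (r * \<epsilon>\<^sup>2) + 4 * \<epsilon> ^ 4"
    using dw s2 rs h3 by linarith
  also have "\<dots> \<le> gauge_pow4 x + gauge_differential x h + 18 * (r * \<epsilon>\<^sup>2 + \<epsilon> ^ 4)"
    using r by (simp add: algebra_simps)
  finally show ?thesis by (simp add: gauge_remainder_def r_def)
qed

text \<open>A crude bound, but it sees \<open>x\<close> only through \<open>gauge_pow4 x\<close>.
  This is what makes the margin in \<open>barrier_strict\<close> uniform on an annulus.\<close>

lemma abs_gauge_differential_le:
  assumes "gauge_pow4 h \<le> \<epsilon> ^ 4" "0 \<le> \<epsilon>" "\<epsilon> \<le> 1"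
  shows "\<bar>gauge_differential x h\<bar> \<le> 10 * (gauge_pow4 x + 1)"
proof -
  define r where "r = (x $ 1)\<^sup>2 + (x $ 2)\<^sup>2"
  define M where "M = gauge_pow4 x"
  define A where "A = 4 * r * x $ 1 - 16 * x $ 3 * x $ 2"
  define B where "B = 4 * r * x $ 2 + 16 * x $ 3 * x $ 1"
  define C where "C = 32 * x $ 3"
  have M: "0 \<le> M" and r: "0 \<le> r" "r \<le> M + 1"
    using radius_le_gauge_pow4[of x] by (auto simp: M_def r_def)
  have "A\<^sup>2 + B\<^sup>2 = 16 * r * M"
    by (simp add: A_def B_def r_def M_def gauge_pow4_def power2_eq_square algebra_simps)
  also have "\<dots> \<le> 16 * (M + 1) * (M + 1)" using M r by (intro mult_mono) auto
  finally have AB: "A\<^sup>2 + B\<^sup>2 \<le> (4 * (M + 1))\<^sup>2" by (simp add: power2_eq_square algebra_simps)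
  have "C\<^sup>2 \<le> 64 * M" by (simp add: C_def M_def gauge_pow4_def power_mult_distrib)
  also have "\<dots> \<le> (8 * (M + 1))\<^sup>2" using M by (simp add: power2_eq_square algebra_simps)
  finally have C: "\<bar>C\<bar> \<le> 8 * (M + 1)" using M by (simp add: power2_le_iff_abs_le)
  have "A\<^sup>2 \<le> (4 * (M + 1))\<^sup>2" "B\<^sup>2 \<le> (4 * (M + 1))\<^sup>2"
    using AB zero_le_power2[of A] zero_le_power2[of B] by linarith+
  then have A: "\<bar>A\<bar> \<le> 4 * (M + 1)" and B: "\<bar>B\<bar> \<le> 4 * (M + 1)"
    using M by (simp_all add: power2_le_iff_abs_le)
  note h = gauge_pow4_le_abs_bounds[OF assms(1,2)]
  have h1: "\<bar>h $ 1\<bar> \<le> 1" "\<bar>h $ 2\<bar> \<le> 1" using h assms by auto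
  have "\<epsilon>\<^sup>2 \<le> 1" using assms by (simp add: power_le_one)
  then have h3: "\<bar>h $ 3\<bar> \<le> 1 / 4" using h(3) by simp
  have "\<bar>A * h $ 1\<bar> \<le> 4 * (M + 1) * 1" "\<bar>B * h $ 2\<bar> \<le> 4 * (M + 1) * 1" "\<bar>C * h $ 3\<bar> \<le> 8 * (M + 1) * (1 / 4)"
    unfolding abs_mult using M by (intro mult_mono A B C h1 h3; simp)+
  moreover have "gauge_differential x h = A * h $ 1 + B * h $ 2 + C * h $ 3"
    by (simp add: gauge_differential_def Let_def A_def B_def C_def r_def)
  ultimately show ?thesis by (simp add: M_def)
qed

text \<open>On a fixed fraction of the ball all three summands of the differential have the favourable sign.
  The squared length of its horizontal part is \<open>16 (x\<^sub>1\<^sup>2 + x\<^sub>2\<^sup>2) \<bar>x\<bar>\<^sup>4\<close>; where this degenerates,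
  near the vertical axis, the vertical part takes over.\<close>
lemma gauge_differential_lower:
  fixes x X :: "real ^ 3"
  assumes \<epsilon>: "0 < \<epsilon>" "\<epsilon> ^ 4 \<le> gauge_pow4 X / 2"
  obtains S where "S \<in> lmeasurable" "measure lebesgue S = \<epsilon> ^ 4 / 256" "S \<subseteq> heis_ball x \<epsilon>"
    "\<And>y. y \<in> S \<Longrightarrow> gauge_pow4 X * gauge_remainder \<epsilon> X / 8 \<le> (gauge_differential X (heis_mult (heis_inv x) y))\<^sup>2"
proof -
  define r where "r = (X $ 1)\<^sup>2 + (X $ 2)\<^sup>2"
  define M where "M = gauge_pow4 X"
  define A where "A = 4 * r * X $ 1 - 16 * X $ 3 * X $ 2"
  define B where "B = 4 * r * X $ 2 + 16 * X $ 3 * X $ 1"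
  define C where "C = 32 * X $ 3"
  \<comment> \<open>The interval of numbers with absolute value between \<open>e / 2\<close> and
    \<open>e\<close> on the side of the sign of \<open>s\<close>, so that \<open>s * t\<close> is at
    least \<open>\<bar>s\<bar> * (e / 2)\<close> there.\<close>
  define lo where "lo s e = (if 0 \<le> s then e / 2 else - e)" for s e :: real
  define hi where "hi s e = (if 0 \<le> s then e else - e / 2)" for s e :: real
  have sgn: "\<bar>s\<bar> * (e / 2) \<le> s * t" "\<bar>t\<bar> \<le> e" if "lo s e \<le> t" "t \<le> hi s e" "0 \<le> e" for s e t
  proof -
    show "\<bar>t\<bar> \<le> e" using that by (auto simp: lo_def hi_def split: if_splits)
    show "\<bar>s\<bar> * (e / 2) \<le> s * t"
    proof (cases "0 \<le> s")
      case True
      then show ?thesis using that mult_left_mono[of "e / 2" t s] by (simp add: lo_def)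
    next
      case False
      then show ?thesis using that mult_left_mono_neg[of t "- e / 2" s] by (simp add: hi_def)
    qed
  qed
  define a b :: "real ^ 3" where "a = vector [lo A (\<epsilon> / 2), lo B (\<epsilon> / 2), lo C (\<epsilon>\<^sup>2 / 8)]"
    and "b = vector [hi A (\<epsilon> / 2), hi B (\<epsilon> / 2), hi C (\<epsilon>\<^sup>2 / 8)]"
  define S where "S = heis_mult x ` cbox a b"
  have box: "\<bar>A\<bar> * (\<epsilon> / 4) \<le> A * h $ 1" "\<bar>h $ 1\<bar> \<le> \<epsilon> / 2"
      "\<bar>B\<bar> * (\<epsilon> / 4) \<le> B * h $ 2" "\<bar>h $ 2\<bar> \<le> \<epsilon> / 2"
      "\<bar>C\<bar> * (\<epsilon>\<^sup>2 / 16) \<le> C * h $ 3" "\<bar>h $ 3\<bar> \<le> \<epsilon>\<^sup>2 / 8" if "h \<in> cbox a b" for h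
    using that sgn[of A "\<epsilon> / 2" "h $ 1"] sgn[of B "\<epsilon> / 2" "h $ 2"] sgn[of C "\<epsilon>\<^sup>2 / 8" "h $ 3"] \<epsilon>(1)
    by (simp_all add: mem_box_cart forall_3 a_def b_def)
  show thesis
  proof
    show "S \<in> lmeasurable" unfolding S_def by (intro lmeasurable_heis_mult_image lmeasurable_cbox)
    have ab: "a $ i \<le> b $ i" for i
      using \<epsilon>(1) exhaust_3[of i] by (auto simp: a_def b_def lo_def hi_def)
    have lohi: "hi s e - lo s e = e / 2" for s e by (simp add: lo_def hi_def)
    have "measure lebesgue S = (\<epsilon> / 4) * (\<epsilon> / 4) * (\<epsilon>\<^sup>2 / 16)"
      unfolding S_def measure_heis_mult_image[OF lmeasurable_cbox] content_cbox_3[OF ab]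
      by (simp add: a_def b_def lohi)
    then show "measure lebesgue S = \<epsilon> ^ 4 / 256" by (simp add: power2_eq_square power4_eq_xxxx)
    show "S \<subseteq> heis_ball x \<epsilon>"
    proof
      fix y assume "y \<in> S"
      then obtain h where h: "h \<in> cbox a b" "y = heis_mult x h" by (auto simp: S_def)
      have "(h $ 1)\<^sup>2 \<le> (\<epsilon> / 2)\<^sup>2" "(h $ 2)\<^sup>2 \<le> (\<epsilon> / 2)\<^sup>2" "(h $ 3)\<^sup>2 \<le> (\<epsilon>\<^sup>2 / 8)\<^sup>2"
        using box[OF h(1)] by (simp_all add: abs_le_square_iff[symmetric] \<epsilon>(1) less_imp_le)
      then have *: "(h $ 1)\<^sup>2 + (h $ 2)\<^sup>2 \<le> \<epsilon>\<^sup>2 / 2" "16 * (h $ 3)\<^sup>2 \<le> \<epsilon> ^ 4 / 4"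
        by (simp_all add: power2_eq_square power4_eq_xxxx)
      have "((h $ 1)\<^sup>2 + (h $ 2)\<^sup>2)\<^sup>2 \<le> (\<epsilon>\<^sup>2 / 2)\<^sup>2" using *(1) by (intro power_mono) auto
      then have "gauge_pow4 h \<le> \<epsilon> ^ 4 / 2"
        using *(2) by (simp add: gauge_pow4_def power_divide flip: power_mult)
      also have "\<dots> < \<epsilon> ^ 4" using \<epsilon>(1) by simp
      finally show "y \<in> heis_ball x \<epsilon>"
        using \<epsilon>(1) h(2) by (simp add: heis_ball_def heis_dist_less_iff)
    qed
    fix y assume "y \<in> S"
    then obtain h where h: "h \<in> cbox a b" "y = heis_mult x h" by (auto simp: S_def)
    define l where "l = gauge_differential X h"
    have l: "l = A * h $ 1 + B * h $ 2 + C * h $ 3"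
      by (simp add: l_def gauge_differential_def Let_def A_def B_def C_def r_def)
    define U where "U = (\<bar>A\<bar> + \<bar>B\<bar>) * (\<epsilon> / 4)"
    define V where "V = \<bar>C\<bar> * (\<epsilon>\<^sup>2 / 16)"
    have UV: "0 \<le> U" "0 \<le> V" using \<epsilon>(1) by (auto simp: U_def V_def)
    have lUV: "U + V \<le> l"
      using box(1,3,5)[OF h(1)] unfolding l U_def V_def distrib_right by linarith
    have "U\<^sup>2 + V\<^sup>2 \<le> (U + V)\<^sup>2" using UV by (simp add: power2_sum)
    also have "\<dots> \<le> l\<^sup>2" using lUV UV by (intro power_mono) auto
    finally have l2: "U\<^sup>2 + V\<^sup>2 \<le> l\<^sup>2" .
    have AB: "A\<^sup>2 + B\<^sup>2 = 16 * r * M"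
      by (simp add: A_def B_def r_def M_def gauge_pow4_def power2_eq_square algebra_simps)
    have "A\<^sup>2 + B\<^sup>2 \<le> (\<bar>A\<bar> + \<bar>B\<bar>)\<^sup>2" by (simp add: power2_sum)
    then have "16 * r * M * (\<epsilon>\<^sup>2 / 16) \<le> (\<bar>A\<bar> + \<bar>B\<bar>)\<^sup>2 * (\<epsilon>\<^sup>2 / 16)"
      unfolding AB by (intro mult_right_mono) auto
    also have "\<dots> = U\<^sup>2" by (simp add: U_def power_mult_distrib power_divide)
    finally have U2: "r * M * \<epsilon>\<^sup>2 \<le> U\<^sup>2" by simp
    have V2: "V\<^sup>2 = 4 * (X $ 3)\<^sup>2 * \<epsilon> ^ 4"
      by (simp add: V_def C_def power_mult_distrib power_divide abs_mult flip: power_mult)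
    have M0: "0 \<le> M" and r0: "0 \<le> r" by (simp_all add: M_def r_def)
    have "M * (r * \<epsilon>\<^sup>2 + \<epsilon> ^ 4) / 8 \<le> U\<^sup>2 + V\<^sup>2"
    \<comment> \<open>If \<open>\<epsilon>\<^sup>2 \<le> r\<close>, then
      \<open>r * \<epsilon>\<^sup>2\<close> dominates \<open>\<epsilon> ^ 4\<close> and the
      horizontal part \<open>U\<close> suffices. Otherwise \<open>r\<^sup>2\<close> is at most
      \<open>\<epsilon> ^ 4\<close>, hence at most half of \<open>M\<close>; the vertical coordinate
      carries the other half and \<open>V\<close> pays for the \<open>\<epsilon> ^ 4\<close>
      term.\<close>
    proof (cases "\<epsilon>\<^sup>2 \<le> r")
      case True
      then have "\<epsilon> ^ 4 \<le> r * \<epsilon>\<^sup>2"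
        using mult_right_mono[OF True, of "\<epsilon>\<^sup>2"] by (simp add: power2_eq_square power4_eq_xxxx)
      then have "M * (r * \<epsilon>\<^sup>2 + \<epsilon> ^ 4) \<le> M * (2 * (r * \<epsilon>\<^sup>2))"
        using M0 by (intro mult_left_mono) auto
      also have "\<dots> \<le> 2 * U\<^sup>2" using U2 by (simp add: algebra_simps)
      finally show ?thesis using zero_le_power2[of U] zero_le_power2[of V] by linarith
    next
      case False
      then have "r\<^sup>2 \<le> (\<epsilon>\<^sup>2)\<^sup>2" using r0 by (intro power_mono) auto
      then have "r\<^sup>2 \<le> M / 2" using \<epsilon>(2) by (simp add: M_def flip: power_mult)
      moreover have "M = r\<^sup>2 + 16 * (X $ 3)\<^sup>2" by (simp add: M_def r_def gauge_pow4_def)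
      ultimately have "M / 8 \<le> 4 * (X $ 3)\<^sup>2" by simp
      then have "M / 8 * \<epsilon> ^ 4 \<le> V\<^sup>2" unfolding V2 by (intro mult_right_mono) auto
      moreover have "r * M * \<epsilon>\<^sup>2 / 8 \<le> r * M * \<epsilon>\<^sup>2" using r0 M0 by simp
      ultimately show ?thesis using U2 by (simp add: algebra_simps)
    qed
    with l2 show "gauge_pow4 X * gauge_remainder \<epsilon> X / 8 \<le> (gauge_differential X (heis_mult (heis_inv x) y))\<^sup>2"
      by (simp add: h(2) l_def[symmetric] M_def r_def gauge_remainder_def)
  qed
qed

subsection \<open>The barrier\<close>

lemma borel_imp_measurable_lebesgue_on:
  "f \<in> borel_measurable borel \<Longrightarrow> f \<in> borel_measurable (lebesgue_on K)"
  by (intro measurable_restrict_space1 measurable_completion) simp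

lemma integrable_signed_powr_continuous:
  fixes f :: "'a::euclidean_space \<Rightarrow> real"
  assumes "compact K" "continuous_on UNIV f" "0 \<le> a"
  shows "integrable (lebesgue_on K) (\<lambda>y. signed_powr a (f y))"
proof -
  obtain B where B: "\<And>y. y \<in> K \<Longrightarrow> \<bar>f y\<bar> \<le> B"
    using compact_imp_bounded[OF compact_continuous_image[OF continuous_on_subset[OF assms(2)] assms(1)]]
    by (auto simp: bounded_iff)
  have [measurable]: "f \<in> borel_measurable borel"
    by (rule borel_measurable_continuous_onI) fact
  show ?thesis
  proof (rule integrable_lebesgue_on_bounded[of K _ "B powr a"])
    show "\<bar>signed_powr a (f y)\<bar> \<le> B powr a" if "y \<in> K" for y
      using B[OF that] assms(3) by (auto simp: abs_signed_powr intro!: powr_mono2)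
    show "(\<lambda>y. signed_powr a (f y)) \<in> borel_measurable (lebesgue_on K)"
      by (rule borel_imp_measurable_lebesgue_on) measurable
  qed (use assms in \<open>auto intro: lmeasurable_compact\<close>)
qed

lemma heis_mult_inv_reflect: "heis_mult (heis_inv x) (2 *\<^sub>R x - y) = - heis_mult (heis_inv x) y"
  by (simp add: vec_eq_iff forall_3 heis_inv_def field_simps)

lemma closure_heis_ball_reflect:
  assumes "y \<in> closure (heis_ball x \<epsilon>)"
  shows "2 *\<^sub>R x - y \<in> closure (heis_ball x \<epsilon>)"
proof -
  have "(\<lambda>y. 2 *\<^sub>R x - y) ` heis_ball x \<epsilon> \<subseteq> closure (heis_ball x \<epsilon>)"
    using closure_subset by (fastforce simp: heis_ball_def heis_dist_def heis_mult_inv_reflect)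
  then have "(\<lambda>y. 2 *\<^sub>R x - y) ` closure (heis_ball x \<epsilon>) \<subseteq> closure (heis_ball x \<epsilon>)"
    by (intro image_closure_subset continuous_intros) auto
  then show ?thesis using assms by auto
qed

lemma measure_closure_heis_ball_le:
  assumes "0 \<le> \<epsilon>"
  shows "measure lebesgue (closure (heis_ball x \<epsilon>)) \<le> 2 * \<epsilon> ^ 4"
proof -
  define d :: "real ^ 3" where "d = vector [\<epsilon>, \<epsilon>, \<epsilon>\<^sup>2 / 4]"
  have d: "(- d) $ i \<le> d $ i" for i
    using assms exhaust_3[of i] by (auto simp: d_def)
  have "measure lebesgue (closure (heis_ball x \<epsilon>)) \<le> measure lebesgue (heis_mult x ` cbox (- d) d)"
    using closure_heis_ball_subset_box[OF assms, of x]
    by (intro measure_mono_fmeasurable lmeasurable_heis_mult_image lmeasurable_cbox)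
       (auto simp: d_def)
  also have "\<dots> = 2 * \<epsilon> ^ 4"
    unfolding measure_heis_mult_image[OF lmeasurable_cbox] content_cbox_3[OF d]
    by (simp add: d_def power2_eq_square power4_eq_xxxx)
  finally show ?thesis .
qed

lemma lmeasurable_closure_heis_ball: "0 \<le> \<epsilon> \<Longrightarrow> closure (heis_ball x \<epsilon>) \<in> lmeasurable"
  by (intro lmeasurable_compact compact_closure_heis_ball)

text \<open>The ball has volume at most \<open>2 \<epsilon>\<^sup>4\<close> and the favourable set has volume \<open>\<epsilon>\<^sup>4 / 256\<close>; the gain on the
  latter wins as soon as \<open>b \<bar>X\<bar>\<^sup>4 > 80 * 4096\<close>, whence the constant \<open>400000\<close>.\<close>
lemma integral_profile_neg:
  fixes x X :: "real ^ 3" and \<epsilon> p b :: real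
  defines "K \<equiv> closure (heis_ball x \<epsilon>)" and "T \<equiv> gauge_remainder \<epsilon> X"
  assumes p: "2 \<le> p" and \<epsilon>: "0 < \<epsilon>" "\<epsilon> ^ 4 \<le> gauge_pow4 X / 2"
    and b: "0 < b" "b * (20 * T) \<le> 1 / 2" "400000 \<le> b * gauge_pow4 X"
  shows "integral\<^sup>L (lebesgue_on K) (\<lambda>y. signed_powr (p - 1)
     (1 - exp (- (b * (gauge_differential X (heis_mult (heis_inv x) y) + 20 * T))))) < 0"
proof -
  let ?I = "integral\<^sup>L (lebesgue_on K)"
  define l where "l y = gauge_differential X (heis_mult (heis_inv x) y)" for y
  define f where "f y = signed_powr (p - 1) (1 - exp (- (b * (l y + 20 * T))))" for y
  have "0 < \<epsilon> ^ 4" using \<epsilon> by simp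
  then have T: "0 < T" using gauge_remainder_ge[of \<epsilon> X] unfolding T_def by linarith
  have K: "compact K" "K \<in> lmeasurable"
    using compact_closure_heis_ball lmeasurable_closure_heis_ball \<epsilon> by (auto simp: K_def)
  have cont_l: "continuous_on UNIV l" unfolding l_def by (intro continuous_intros)
  have l_reflect: "l (2 *\<^sub>R x - y) = - l y" for y by (simp add: l_def heis_mult_inv_reflect)
  have int_f: "integrable (lebesgue_on K) f"
    unfolding f_def using p by (intro integrable_signed_powr_continuous K continuous_intros cont_l) auto
  have int_f': "integrable (lebesgue_on K) (\<lambda>y. f (2 *\<^sub>R x - y))"
    unfolding f_def l_reflect using p by (intro integrable_signed_powr_continuous K continuous_intros cont_l) auto
  obtain \<gamma> where \<gamma>: "0 < \<gamma>" "\<And>l. signed_powr (p - 1) (1 - exp (- (b * (l + 20 * T))))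
      + signed_powr (p - 1) (1 - exp (- (b * (- l + 20 * T))))
      \<le> \<gamma> * (2 - 2 * exp (- (b * (20 * T))) * cosh (b * l))"
    using signed_powr_exp_pair[OF b(1), of "20 * T" p] T p by auto
  obtain S where S: "S \<in> lmeasurable" "measure lebesgue S = \<epsilon> ^ 4 / 256" "S \<subseteq> heis_ball x \<epsilon>"
    "\<And>y. y \<in> S \<Longrightarrow> gauge_pow4 X * T / 8 \<le> (l y)\<^sup>2"
    using gauge_differential_lower[OF \<epsilon>, of x] by (auto simp: T_def l_def)
  have SK: "S \<subseteq> K" using S(3) closure_subset by (auto simp: K_def)
  \<comment> \<open>The loss \<open>40 * b * T\<close> caused by the remainder is charged on the
    whole ball, the gain from the differential is counted only on \<open>S\<close>.\<close>
  define h where "h y = \<gamma> * (40 * b * T - b\<^sup>2 * gauge_pow4 X * T / 16 * indicat_real S y)" for y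
  have pair: "f y + f (2 *\<^sub>R x - y) \<le> h y" for y
  proof -
    \<comment> \<open>Expanding \<open>exp\<close> to first and \<open>cosh\<close> to second order
      leaves the gain \<open>(b * l y)\<^sup>2\<close> with the factor
      \<open>1 - b * (20 * T)\<close>, which is at least \<open>1/2\<close>.\<close>
    have *: "40 * b * T - b\<^sup>2 * (l y)\<^sup>2 / 2 \<ge> 2 - 2 * exp (- (b * (20 * T))) * cosh (b * l y)"
    proof -
      have "1 - b * (20 * T) \<le> exp (- (b * (20 * T)))"
        using exp_ge_add_one_self[of "- (b * (20 * T))"] by simp
      then have "(1 - b * (20 * T)) * (1 + (b * l y)\<^sup>2 / 2) \<le> exp (- (b * (20 * T))) * cosh (b * l y)"
        using b cosh_lower_quadratic[of "b * l y"] by (intro mult_mono) auto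
      moreover have "(1 / 2) * (b * l y)\<^sup>2 \<le> (1 - b * (20 * T)) * (b * l y)\<^sup>2"
        using b by (intro mult_right_mono) auto
      moreover have "(1 - b * (20 * T)) * (1 + (b * l y)\<^sup>2 / 2)
          = 1 - b * (20 * T) + (1 - b * (20 * T)) * (b * l y)\<^sup>2 / 2"
        by (simp add: distrib_left)
      moreover have "(b * l y)\<^sup>2 = b\<^sup>2 * (l y)\<^sup>2" by (rule power_mult_distrib)
      ultimately show ?thesis by linarith
    qed
    have "f y + f (2 *\<^sub>R x - y) \<le> \<gamma> * (2 - 2 * exp (- (b * (20 * T))) * cosh (b * l y))"
      using \<gamma>(2)[of "l y"] unfolding f_def l_reflect .
    also have "\<dots> \<le> \<gamma> * (40 * b * T - b\<^sup>2 * (l y)\<^sup>2 / 2)"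
      using \<gamma>(1) * by (intro mult_left_mono) auto
    also have "\<dots> \<le> h y"
    proof (cases "y \<in> S")
      case True
      have "b\<^sup>2 * (gauge_pow4 X * T / 8) \<le> b\<^sup>2 * (l y)\<^sup>2" using S(4)[OF True] by (intro mult_left_mono) auto
      then show ?thesis using \<gamma>(1) True by (simp add: h_def mult_ac)
    qed (use \<gamma>(1) in \<open>simp add: h_def\<close>)
    finally show ?thesis .
  qed
  have int_S: "integrable (lebesgue_on K) (\<lambda>y. indicat_real S y)"
    using S(1) K(2) by (intro integrable_lebesgue_on_bounded[of K _ 1])
      (auto intro!: measurable_restrict_space1 simp: fmeasurableD indicator_def)
  have int_const: "integrable (lebesgue_on K) (\<lambda>_. 40 * b * T)"
    using K(2) by (rule integrable_lebesgue_on_bounded[where B = "\<bar>40 * b * T\<bar>"]) auto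
  have int_h: "integrable (lebesgue_on K) h"
    unfolding h_def
    by (intro Bochner_Integration.integrable_mult_right Bochner_Integration.integrable_diff int_S int_const)
  have "?I f + ?I f = ?I f + ?I (\<lambda>y. f (2 *\<^sub>R x - y))"
    using integral_lebesgue_on_point_reflect[of K "2 *\<^sub>R x" f] K(2) int_f closure_heis_ball_reflect
    by (simp add: K_def fmeasurableD borel_measurable_integrable)
  also have "\<dots> = ?I (\<lambda>y. f y + f (2 *\<^sub>R x - y))"
    using int_f int_f' by simp
  also have "\<dots> \<le> ?I h"
    using int_f int_f' by (intro integral_mono pair int_h) auto
  also have "?I h = \<gamma> * (40 * b * T * measure lebesgue K - b\<^sup>2 * gauge_pow4 X * T / 16 * measure lebesgue S)"
  proof -
    have "?I (indicat_real S) = measure lebesgue S"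
      using K(2) S(1) SK
      by (simp add: measure_restrict_space fmeasurableD Int_absorb2 Int_absorb1)
    moreover have "?I (\<lambda>y. 40 * b * T - b\<^sup>2 * gauge_pow4 X * T / 16 * indicat_real S y)
        = ?I (\<lambda>_. 40 * b * T) - ?I (\<lambda>y. b\<^sup>2 * gauge_pow4 X * T / 16 * indicat_real S y)"
      by (intro Bochner_Integration.integral_diff int_const Bochner_Integration.integrable_mult_right int_S)
    ultimately show ?thesis
      unfolding h_def by (simp only: integral_mult_right_zero integral_lebesgue_on_const[OF K(2)] mult.assoc)
  qed
  also have "\<dots> < 0"
  proof -
    have "40 * b * T * measure lebesgue K \<le> 40 * b * T * (2 * \<epsilon> ^ 4)"
      using measure_closure_heis_ball_le[of \<epsilon> x] b T \<epsilon> by (intro mult_left_mono) (auto simp: K_def)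
    also have "\<dots> = b * T * \<epsilon> ^ 4 * 80" by simp
    also have "\<dots> < b * T * \<epsilon> ^ 4 * (b * gauge_pow4 X / 4096)"
      using b T \<epsilon> by (intro mult_strict_left_mono mult_pos_pos) auto
    also have "\<dots> = b\<^sup>2 * gauge_pow4 X * T / 16 * measure lebesgue S"
      by (simp add: S(2) power2_eq_square)
    finally show ?thesis using \<gamma>(1) by (intro mult_pos_neg) auto
  qed
  finally show ?thesis by (simp add: f_def[abs_def] l_def)
qed

text \<open>The integrand is the signed power of the increment from \<open>x\<close> to
  \<open>y\<close> of \<open>c - A exp (- b gauge_pow4)\<close>, raised by \<open>\<kappa>\<close>.
  The margin depends on \<open>\<epsilon>\<close> but not on \<open>x\<close> or \<open>z\<close>.
  It comes from the gap between the \<open>18 T\<close> of the expansion and the \<open>20 T\<close>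
  that the exponential profile tolerates.\<close>

lemma barrier_strict:
  fixes p A m0 m1 b \<epsilon> :: real
  assumes p: "2 \<le> p" and A: "0 < A" and m: "0 < m0" "m0 \<le> m1" and b: "b = 400000 / m0"
    and \<epsilon>: "0 < \<epsilon>" "\<epsilon> \<le> 1" "\<epsilon> ^ 4 \<le> m0 / 2" "b * (20 * (m1 + 2)) * \<epsilon>\<^sup>2 \<le> 1 / 2"
  obtains \<kappa> where "0 < \<kappa>"
    "\<And>x z. m0 \<le> gauge_pow4 (heis_mult (heis_inv z) x) \<Longrightarrow> gauge_pow4 (heis_mult (heis_inv z) x) \<le> m1 \<Longrightarrow>
       integral\<^sup>L (lebesgue_on (closure (heis_ball x \<epsilon>))) (\<lambda>y. signed_powr (p - 1)
         (A * (exp (- (b * gauge_pow4 (heis_mult (heis_inv z) x)))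
             - exp (- (b * gauge_pow4 (heis_mult (heis_inv z) y)))) + \<kappa>)) < 0"
proof
  \<comment> \<open>A lower bound on the annulus for
    \<open>exp (- (b * (l + 18 * T))) - exp (- (b * (l + 20 * T)))\<close>, from
    \<open>l \<le> 10 * (m1 + 1)\<close>, \<open>20 * b * T \<le> 1 / 2\<close> and
    \<open>\<epsilon> ^ 4 \<le> T\<close>.\<close>
  define c where "c = exp (- (b * (10 * (m1 + 1)) + 1 / 2)) * (2 * b * \<epsilon> ^ 4)"
  define \<kappa> where "\<kappa> = A * exp (- (b * m1)) * c"
  have b0: "0 < b" using b m by simp
  have c0: "0 < c" using b0 \<epsilon> by (simp add: c_def)
  show "0 < \<kappa>" using A c0 by (simp add: \<kappa>_def)
  fix x z
  define X where "X = heis_mult (heis_inv z) x"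
  define M where "M = gauge_pow4 X"
  define T where "T = gauge_remainder \<epsilon> X"
  define K where "K = closure (heis_ball x \<epsilon>)"
  define l where "l y = gauge_differential X (heis_mult (heis_inv x) y)" for y
  define A' where "A' = A * exp (- (b * M))"
  assume "m0 \<le> gauge_pow4 (heis_mult (heis_inv z) x)" "gauge_pow4 (heis_mult (heis_inv z) x) \<le> m1"
  then have M: "m0 \<le> M" "M \<le> m1" by (simp_all add: M_def X_def)
  have T: "\<epsilon> ^ 4 \<le> T" by (simp add: T_def gauge_remainder_ge)
  have "T \<le> (M + 2) * \<epsilon>\<^sup>2" unfolding T_def M_def using \<epsilon> by (intro gauge_remainder_le) auto
  also have "\<dots> \<le> (m1 + 2) * \<epsilon>\<^sup>2" using M by (intro mult_right_mono) auto
  finally have "T \<le> (m1 + 2) * \<epsilon>\<^sup>2" .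
  then have "b * (20 * T) \<le> b * (20 * ((m1 + 2) * \<epsilon>\<^sup>2))" using b0 by (intro mult_left_mono) auto
  also have "\<dots> = b * (20 * (m1 + 2)) * \<epsilon>\<^sup>2" by simp
  finally have bT: "b * (20 * T) \<le> 1 / 2" using \<epsilon>(4) by linarith
  have bM: "400000 \<le> b * M" using mult_left_mono[OF M(1), of b] b b0 m by simp
  have A': "0 < A'" using A by (simp add: A'_def)
  have K: "compact K" unfolding K_def using \<epsilon> by (intro compact_closure_heis_ball) auto
  have cont_l: "continuous_on UNIV l" unfolding l_def by (intro continuous_intros)
  have "A * (exp (- (b * M)) - exp (- (b * gauge_pow4 (heis_mult (heis_inv z) y)))) + \<kappa>
      \<le> A' * (1 - exp (- (b * (l y + 20 * T))))" if "y \<in> K" for y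
  proof -
    define h where "h = heis_mult (heis_inv x) y"
    have Xh: "heis_mult (heis_inv z) y = heis_mult X h"
      by (simp add: X_def h_def heis_mult_assoc)
    have h: "gauge_pow4 h \<le> \<epsilon> ^ 4"
      using closure_heis_ball_le[of y x \<epsilon>] that \<epsilon> by (simp add: K_def h_def heis_dist_le_iff)
    have lh: "l y = gauge_differential X h" by (simp add: l_def h_def)
    have "gauge_pow4 (heis_mult X h) \<le> M + l y + 18 * T"
      using gauge_pow4_mult_le[OF h, of X] by (simp add: M_def lh T_def)
    then have "b * gauge_pow4 (heis_mult X h) \<le> b * (M + l y + 18 * T)"
      using b0 by (intro mult_left_mono) auto
    then have "exp (- (b * M)) * exp (- (b * (l y + 18 * T))) \<le> exp (- (b * gauge_pow4 (heis_mult X h)))"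
      unfolding exp_add[symmetric] by (simp add: algebra_simps)
    then have 1: "A' * exp (- (b * (l y + 18 * T))) \<le> A * exp (- (b * gauge_pow4 (heis_mult X h)))"
      using A by (simp add: A'_def mult.assoc)
    have "l y \<le> 10 * (M + 1)"
      using abs_gauge_differential_le[OF h, of X] \<epsilon> by (simp add: lh M_def abs_le_iff)
    also have "\<dots> \<le> 10 * (m1 + 1)" using M by simp
    finally have "b * l y \<le> b * (10 * (m1 + 1))" using b0 by (intro mult_left_mono) auto
    then have e: "exp (- (b * (10 * (m1 + 1)) + 1 / 2)) \<le> exp (- (b * (l y + 20 * T)))"
      using bT by (simp add: algebra_simps)
    have "2 * b * \<epsilon> ^ 4 \<le> 2 * b * T" using T b0 by (intro mult_left_mono) auto
    also have "\<dots> \<le> exp (2 * b * T) - 1" using exp_ge_add_one_self[of "2 * b * T"] by linarith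
    finally have "c \<le> exp (- (b * (l y + 20 * T))) * (exp (2 * b * T) - 1)"
      unfolding c_def using e b0 \<epsilon> by (intro mult_mono) auto
    also have "\<dots> = exp (- (b * (l y + 18 * T))) - exp (- (b * (l y + 20 * T)))"
      by (simp add: right_diff_distrib exp_add[symmetric] algebra_simps)
    finally have c: "A' * c \<le> A' * (exp (- (b * (l y + 18 * T))) - exp (- (b * (l y + 20 * T))))"
      using A' by (intro mult_left_mono) auto
    have "\<kappa> \<le> A' * c"
      unfolding \<kappa>_def A'_def using A c0 M b0 by (intro mult_right_mono mult_left_mono) auto
    with 1 c show ?thesis unfolding Xh by (simp add: algebra_simps A'_def)
  qed
  then have "integral\<^sup>L (lebesgue_on K) (\<lambda>y. signed_powr (p - 1)
         (A * (exp (- (b * M)) - exp (- (b * gauge_pow4 (heis_mult (heis_inv z) y)))) + \<kappa>))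
     \<le> integral\<^sup>L (lebesgue_on K) (\<lambda>y. signed_powr (p - 1) (A' * (1 - exp (- (b * (l y + 20 * T))))))"
    using p by (intro integral_mono integrable_signed_powr_continuous K continuous_intros cont_l signed_powr_mono) auto
  also have "\<dots> = A' powr (p - 1) * integral\<^sup>L (lebesgue_on K)
      (\<lambda>y. signed_powr (p - 1) (1 - exp (- (b * (l y + 20 * T)))))"
    using A' by (simp add: signed_powr_mult)
  also have "\<dots> < 0"
    using integral_profile_neg[OF p \<epsilon>(1), of X b x] \<epsilon>(3) M b0 bT bM A'
    by (intro mult_pos_neg) (auto simp: M_def T_def K_def l_def)
  finally show "integral\<^sup>L (lebesgue_on (closure (heis_ball x \<epsilon>))) (\<lambda>y. signed_powr (p - 1)
         (A * (exp (- (b * gauge_pow4 (heis_mult (heis_inv z) x)))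
             - exp (- (b * gauge_pow4 (heis_mult (heis_inv z) y)))) + \<kappa>)) < 0"
    by (simp add: K_def M_def X_def)
qed

lemma measure_closure_heis_ball_pos:
  assumes "0 < \<epsilon>"
  shows "0 < measure lebesgue (closure (heis_ball x \<epsilon>))"
proof -
  \<comment> \<open>In \<open>gauge_differential_lower\<close> the centre of the ball and the point
    of differentiation are unrelated. Any \<open>X\<close> with large enough gauge yields a subset
    of the ball of known positive volume; here \<open>gauge_pow4 X\<close> is
    \<open>16 * \<epsilon> ^ 4\<close>.\<close>
  define X :: "real ^ 3" where "X = axis 3 (\<epsilon>\<^sup>2)"
  have "\<epsilon> ^ 4 \<le> gauge_pow4 X / 2"
    by (simp add: X_def gauge_pow4_def axis_def flip: power_mult)
  then obtain S where S: "S \<in> lmeasurable" "measure lebesgue S = \<epsilon> ^ 4 / 256" "S \<subseteq> heis_ball x \<epsilon>"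
    using gauge_differential_lower[OF assms] by metis
  have "measure lebesgue S \<le> measure lebesgue (closure (heis_ball x \<epsilon>))"
    using S closure_subset[of "heis_ball x \<epsilon>"] assms
    by (intro measure_mono_fmeasurable lmeasurable_closure_heis_ball) (auto simp: fmeasurableD)
  then show ?thesis using S(2) assms by simp (smt (verit) zero_less_power)
qed

text \<open>Where \<open>v\<close> exceeds the barrier by almost the supremum of the excess, \<open>v\<close> minus its value lies
  below the increment of the barrier plus a small constant on the whole ball, which contradicts
  the strict mean value inequality for the barrier.\<close>
lemma barrier_comparison:
  fixes v :: "real ^ 3 \<Rightarrow> real" and D :: "(real ^ 3) set"
  assumes p: "2 \<le> p" and A: "0 < A" and m: "0 < m0" "m0 \<le> m1" and b: "b = 400000 / m0"
    and \<epsilon>: "0 < \<epsilon>" "\<epsilon> \<le> 1" "\<epsilon> ^ 4 \<le> m0 / 2" "b * (20 * (m1 + 2)) * \<epsilon>\<^sup>2 \<le> 1 / 2"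
    and meas: "\<And>x. x \<in> D \<Longrightarrow> v \<in> borel_measurable (lebesgue_on (closure (heis_ball x \<epsilon>)))"
    and bdd: "\<And>x. x \<in> D \<Longrightarrow> \<bar>v x\<bar> \<le> B"
      "\<And>x y. x \<in> D \<Longrightarrow> y \<in> closure (heis_ball x \<epsilon>) \<Longrightarrow> \<bar>v y\<bar> \<le> B"
    and centre: "\<And>x. x \<in> D \<Longrightarrow> Lp_centre p (closure (heis_ball x \<epsilon>)) v (v x)"
    and annulus: "\<And>x. x \<in> D \<Longrightarrow> m0 \<le> gauge_pow4 (heis_mult (heis_inv z) x) \<and> gauge_pow4 (heis_mult (heis_inv z) x) \<le> m1"
    and outer: "\<And>x y. x \<in> D \<Longrightarrow> y \<in> closure (heis_ball x \<epsilon>) \<Longrightarrow> y \<notin> D \<Longrightarrow>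
       v y \<le> c - A * exp (- (b * gauge_pow4 (heis_mult (heis_inv z) y)))"
    and x: "x \<in> D"
  shows "v x \<le> c - A * exp (- (b * gauge_pow4 (heis_mult (heis_inv z) x)))"
proof (rule ccontr)
  define W where "W y = c - A * exp (- (b * gauge_pow4 (heis_mult (heis_inv z) y)))" for y
  assume "\<not> ?thesis"
  then have pos: "0 < v x - W x" by (simp add: W_def)
  obtain \<kappa> where \<kappa>: "0 < \<kappa>"
    "\<And>x z. m0 \<le> gauge_pow4 (heis_mult (heis_inv z) x) \<Longrightarrow> gauge_pow4 (heis_mult (heis_inv z) x) \<le> m1 \<Longrightarrow>
       integral\<^sup>L (lebesgue_on (closure (heis_ball x \<epsilon>))) (\<lambda>y. signed_powr (p - 1)
         (A * (exp (- (b * gauge_pow4 (heis_mult (heis_inv z) x)))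
             - exp (- (b * gauge_pow4 (heis_mult (heis_inv z) y)))) + \<kappa>)) < 0"
    using barrier_strict[OF p A m b \<epsilon>] by blast
  define E where "E = (SUP y\<in>D. v y - W y)"
  have b0: "0 \<le> b" using b m by simp
  have W_bound: "c - A \<le> W y" for y
    using A b0 by (auto simp: W_def)
  have bddE: "bdd_above ((\<lambda>y. v y - W y) ` D)"
  proof (rule bdd_aboveI2)
    fix y assume "y \<in> D"
    then show "v y - W y \<le> B - (c - A)" using bdd(1) W_bound[of y] by (smt (verit))
  qed
  have E_ge: "v y - W y \<le> E" if "y \<in> D" for y
    unfolding E_def by (rule cSUP_upper[OF that bddE])
  have E0: "0 < E" using E_ge[OF x] pos by linarith
  have "E - \<kappa> / 2 < (SUP y\<in>D. v y - W y)" using \<kappa>(1) by (simp add: E_def)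
  then obtain x0 where x0: "x0 \<in> D" "E - \<kappa> / 2 < v x0 - W x0"
    using less_cSUP_iff[OF _ bddE] x by blast
  define K where "K = closure (heis_ball x0 \<epsilon>)"
  have K: "K \<in> lmeasurable" "0 < measure lebesgue K" "compact K"
    using \<epsilon> unfolding K_def
    by (simp_all only: lmeasurable_closure_heis_ball measure_closure_heis_ball_pos compact_closure_heis_ball less_imp_le)
  have p1: "1 < p" using p by simp
  \<comment> \<open>Half of \<open>\<kappa>\<close> is spent on lowering the centre
    \<open>v x0\<close>, the other half on the distance of the excess at \<open>x0\<close> from its
    supremum \<open>E\<close>.\<close>
  have "0 \<le> integral\<^sup>L (lebesgue_on K) (\<lambda>y. signed_powr (p - 1) (v y - (v x0 - \<kappa> / 2)))"
    using \<kappa>(1) meas[OF x0(1)] bdd(2)[OF x0(1)] centre[OF x0(1)]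
    by (intro Lp_centre_upper[OF K(1,2) _ _ p1, of v B]) (auto simp: K_def)
  also have "\<dots> \<le> integral\<^sup>L (lebesgue_on K) (\<lambda>y. signed_powr (p - 1) (W y - W x0 + \<kappa>))"
  proof (rule integral_mono)
    show "integrable (lebesgue_on K) (\<lambda>y. signed_powr (p - 1) (v y - (v x0 - \<kappa> / 2)))"
      using meas[OF x0(1)] bdd(2)[OF x0(1)]
      by (intro integrable_signed_powr_diff[OF K(1,2) _ _ p1, of v B]) (auto simp: K_def)
    show "integrable (lebesgue_on K) (\<lambda>y. signed_powr (p - 1) (W y - W x0 + \<kappa>))"
      unfolding W_def using p by (intro integrable_signed_powr_continuous K continuous_intros) auto
    fix y assume "y \<in> space (lebesgue_on K)"
    then have y: "y \<in> K" by simp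
    have "v y - W y \<le> E"
    proof (cases "y \<in> D")
      case False
      then show ?thesis using outer[OF x0(1)] y E0 by (fastforce simp: K_def W_def)
    qed (rule E_ge)
    then show "signed_powr (p - 1) (v y - (v x0 - \<kappa> / 2)) \<le> signed_powr (p - 1) (W y - W x0 + \<kappa>)"
      using x0(2) p by (intro signed_powr_mono) auto
  qed
  also have "(\<lambda>y. W y - W x0 + \<kappa>) = (\<lambda>y. A * (exp (- (b * gauge_pow4 (heis_mult (heis_inv z) x0)))
             - exp (- (b * gauge_pow4 (heis_mult (heis_inv z) y)))) + \<kappa>)"
    by (simp add: W_def algebra_simps)
  then have "integral\<^sup>L (lebesgue_on K) (\<lambda>y. signed_powr (p - 1) (W y - W x0 + \<kappa>)) < 0"
    using \<kappa>(2)[of z x0] annulus[OF x0(1)] by (simp add: K_def fun_eq_iff)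
  finally show False by simp
qed

subsection \<open>Boundary estimates\<close>

lemma heis_infdist_le: "a \<in> A \<Longrightarrow> heis_infdist x A \<le> heis_dist x a"
  unfolding heis_infdist_def by (rule cINF_lower) (auto intro!: bdd_belowI2[of _ 0])

lemma heis_infdist_triangle:
  assumes "A \<noteq> {}"
  shows "heis_infdist x A \<le> heis_dist x y + heis_infdist y A"
proof -
  have "heis_infdist x A - heis_dist x y \<le> heis_dist y a" if "a \<in> A" for a
    using heis_infdist_le[OF that, of x] heis_dist_triangle[of x a y] by linarith
  then have "heis_infdist x A - heis_dist x y \<le> heis_infdist y A"
    unfolding heis_infdist_def[of y] using assms by (intro cINF_greatest) auto
  then show ?thesis by linarith
qed

lemma closed_heis_infdist_le:
  assumes "A \<noteq> {}"
  shows "closed {x. heis_infdist x A \<le> e}"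
  unfolding closed_sequential_limits
proof (intro allI impI)
  fix s l assume s: "(\<forall>n. s n \<in> {x. heis_infdist x A \<le> e}) \<and> s \<longlonglongrightarrow> l"
  have "continuous_on UNIV (heis_dist l)" by (intro continuous_intros)
  then have "isCont (heis_dist l) l" by (simp add: continuous_on_eq_continuous_at)
  then have "(\<lambda>n. heis_dist l (s n)) \<longlonglongrightarrow> heis_dist l l"
    by (rule isCont_tendsto_compose) (use s in simp)
  then have "(\<lambda>n. heis_dist l (s n) + e) \<longlonglongrightarrow> 0 + e"
    by (intro tendsto_add tendsto_const) simp
  moreover have "heis_infdist l A \<le> heis_dist l (s n) + e" for n
  proof -
    have "heis_infdist (s n) A \<le> e" using s by simp
    then show ?thesis using heis_infdist_triangle[OF assms, of l "s n"] by linarith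
  qed
  ultimately show "l \<in> {x. heis_infdist x A \<le> e}"
    by (auto intro: LIMSEQ_le_const)
qed

lemma bounded_heis_ball: "0 \<le> r \<Longrightarrow> bounded (heis_ball x r)"
  using compact_closure_heis_ball[of r x] bounded_subset[OF compact_imp_bounded closure_subset] by blast

lemma open_heis_ball: "open (heis_ball x r)"
  unfolding heis_ball_def by (intro open_Collect_less continuous_intros)

text \<open>Compactness turns the continuity of \<open>G\<close> into a bound, which starts the
  iteration.\<close>

lemma compact_boundary_strip:
  assumes "open \<Omega>" "bounded \<Omega>" "\<Omega> \<noteq> {}"
  shows "compact (boundary_strip \<Omega> 1)"
proof -
  have "compact (heis_dist 0 ` closure \<Omega>)"
    using assms(2) by (intro compact_continuous_image continuous_intros) (simp add: compact_closure)
  then obtain R where R: "\<And>a. a \<in> \<Omega> \<Longrightarrow> heis_dist 0 a \<le> R"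
    using closure_subset[of \<Omega>] by (fastforce dest!: compact_imp_bounded simp: bounded_iff)
  have "boundary_strip \<Omega> 1 \<subseteq> heis_ball 0 (\<bar>R\<bar> + 2)"
  proof
    fix x assume "x \<in> boundary_strip \<Omega> 1"
    then have "heis_infdist x \<Omega> < 2" by (simp add: boundary_strip_def)
    then obtain a where "a \<in> \<Omega>" "heis_dist x a < 2"
      unfolding heis_infdist_def using assms(3)
      by (subst (asm) cINF_less_iff) (auto intro!: bdd_belowI2[of _ 0])
    then show "x \<in> heis_ball 0 (\<bar>R\<bar> + 2)"
      using R[of a] heis_dist_triangle[of 0 x a] heis_dist_commute[of x a]
      by (auto simp: heis_ball_def)
  qed
  then have "bounded (boundary_strip \<Omega> 1)"
    using bounded_heis_ball[of "\<bar>R\<bar> + 2"] bounded_subset by auto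
  moreover have "boundary_strip \<Omega> 1 = - \<Omega> \<inter> {x. heis_infdist x \<Omega> \<le> 1}"
    by (auto simp: boundary_strip_def)
  then have "closed (boundary_strip \<Omega> 1)"
    using assms closed_heis_infdist_le[of \<Omega> 1] by (metis closed_Compl closed_Int)
  ultimately show ?thesis by (simp add: compact_eq_bounded_closed)
qed

lemma frontier_subset_boundary_strip:
  assumes "open \<Omega>" "0 < \<epsilon>"
  shows "frontier \<Omega> \<subseteq> boundary_strip \<Omega> \<epsilon>"
proof
  fix y assume y: "y \<in> frontier \<Omega>"
  then have "y \<in> closure \<Omega>" "y \<notin> \<Omega>"
    using assms by (auto simp: frontier_def interior_open)
  moreover have "y \<in> heis_ball y \<epsilon>" using assms by (simp add: heis_ball_def)
  ultimately have "heis_ball y \<epsilon> \<inter> \<Omega> \<noteq> {}"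
    using open_Int_closure_eq_empty[OF open_heis_ball[of y \<epsilon>], of \<Omega>] by blast
  then obtain a where "a \<in> \<Omega>" "heis_dist y a < \<epsilon>" by (auto simp: heis_ball_def)
  then show "y \<in> boundary_strip \<Omega> \<epsilon>"
    using heis_infdist_le[of a \<Omega> y] \<open>y \<notin> \<Omega>\<close> by (simp add: boundary_strip_def)
qed

lemma closure_heis_ball_strip:
  assumes "x \<in> \<Omega>" "y \<in> closure (heis_ball x \<epsilon>)" "y \<notin> \<Omega>"
  shows "y \<in> boundary_strip \<Omega> \<epsilon>"
  using heis_infdist_le[OF assms(1), of y] closure_heis_ball_le[OF assms(2)] assms(3)
  by (simp add: boundary_strip_def heis_dist_commute[of y])

section \<open>Comparison of solutions with barriers\<close>

text \<open>The boundary value problem in a form stable under \<open>u \<mapsto> - u\<close>,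
  \<open>G \<mapsto> - G\<close>, so that a lower estimate is an upper estimate for the negated
  data.\<close>

definition Lp_centre_bvp ::
  "(real ^ 3) set \<Rightarrow> (real ^ 3 \<Rightarrow> real) \<Rightarrow> real \<Rightarrow> real \<Rightarrow> (real ^ 3 \<Rightarrow> real) \<Rightarrow> bool" where
  "Lp_centre_bvp \<Omega> G p \<epsilon> u \<longleftrightarrow>
     (\<exists>B. \<forall>y\<in>extended_domain \<Omega> \<epsilon>. \<bar>u y\<bar> \<le> B) \<and>
     (\<forall>x\<in>\<Omega>. u \<in> borel_measurable (lebesgue_on (closure (heis_ball x \<epsilon>))) \<and>
        Lp_centre p (closure (heis_ball x \<epsilon>)) u (u x)) \<and>
     (\<forall>x\<in>boundary_strip \<Omega> \<epsilon>. u x = G x)"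

lemma Lp_centre_bvp_uminus:
  "Lp_centre_bvp \<Omega> G p \<epsilon> u \<Longrightarrow> Lp_centre_bvp \<Omega> (\<lambda>x. - G x) p \<epsilon> (\<lambda>x. - u x)"
  unfolding Lp_centre_bvp_def by (simp add: Lp_centre_uminus)

lemma solves_p_mean_bvp_imp_Lp_centre_bvp:
  assumes "solves_p_mean_bvp \<Omega> G p \<epsilon> u" "1 < p" "0 < \<epsilon>"
  shows "Lp_centre_bvp \<Omega> G p \<epsilon> u"
proof -
  obtain B where B: "\<And>y. y \<in> extended_domain \<Omega> \<epsilon> \<Longrightarrow> \<bar>u y\<bar> \<le> B"
    using assms(1) by (auto simp: solves_p_mean_bvp_def bounded_measurable_on_def bounded_iff)
  have "u \<in> borel_measurable (lebesgue_on (closure (heis_ball x \<epsilon>))) \<and>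
        Lp_centre p (closure (heis_ball x \<epsilon>)) u (u x)" if x: "x \<in> \<Omega>" for x
  proof -
    have sub: "closure (heis_ball x \<epsilon>) \<subseteq> extended_domain \<Omega> \<epsilon>"
      using closure_heis_ball_strip[OF x] by (auto simp: extended_domain_def)
    have meas: "u \<in> borel_measurable (lebesgue_on (closure (heis_ball x \<epsilon>)))"
      using assms(1) sub
      by (auto simp: solves_p_mean_bvp_def bounded_measurable_on_def intro: measurable_restrict_mono)
    have "u x = natural_p_mean p u \<epsilon> x" using assms(1) x by (simp add: solves_p_mean_bvp_def)
    moreover have "Lp_centre p (closure (heis_ball x \<epsilon>)) u (natural_p_mean p u \<epsilon> x)"
      using sub B assms(2,3) measure_closure_heis_ball_pos
      by (intro natural_p_mean_Lp_centre[of x \<epsilon> u B] meas lmeasurable_closure_heis_ball) auto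
    ultimately show ?thesis using meas by simp
  qed
  then show ?thesis
    using B assms(1) unfolding Lp_centre_bvp_def solves_p_mean_bvp_def by blast
qed

lemma Lp_centre_bvp_comparison:
  assumes bvp: "Lp_centre_bvp \<Omega> G p \<epsilon> u" and D: "D \<subseteq> \<Omega>"
    and p: "2 \<le> p" and A: "0 < A" and m: "0 < m0" "m0 \<le> m1" and b: "b = 400000 / m0"
    and \<epsilon>: "0 < \<epsilon>" "\<epsilon> \<le> 1" "\<epsilon> ^ 4 \<le> m0 / 2" "b * (20 * (m1 + 2)) * \<epsilon>\<^sup>2 \<le> 1 / 2"
    and annulus: "\<And>x. x \<in> D \<Longrightarrow> m0 \<le> gauge_pow4 (heis_mult (heis_inv z) x) \<and> gauge_pow4 (heis_mult (heis_inv z) x) \<le> m1"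
    and outer: "\<And>x y. x \<in> D \<Longrightarrow> y \<in> closure (heis_ball x \<epsilon>) \<Longrightarrow> y \<notin> D \<Longrightarrow>
       u y \<le> c - A * exp (- (b * gauge_pow4 (heis_mult (heis_inv z) y)))"
    and x: "x \<in> D"
  shows "u x \<le> c - A * exp (- (b * gauge_pow4 (heis_mult (heis_inv z) x)))"
proof -
  obtain B where B: "\<And>y. y \<in> extended_domain \<Omega> \<epsilon> \<Longrightarrow> \<bar>u y\<bar> \<le> B"
    using bvp by (auto simp: Lp_centre_bvp_def)
  show ?thesis
  proof (rule barrier_comparison[OF p A m b \<epsilon> _ _ _ _ annulus outer x, where B = B])
    fix x assume "x \<in> D"
    then have x: "x \<in> \<Omega>" using D by blast
    then show "u \<in> borel_measurable (lebesgue_on (closure (heis_ball x \<epsilon>)))"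
      "Lp_centre p (closure (heis_ball x \<epsilon>)) u (u x)"
      using bvp by (auto simp: Lp_centre_bvp_def)
    show "\<bar>u x\<bar> \<le> B" using x B by (simp add: extended_domain_def)
    show "\<bar>u y\<bar> \<le> B" if "y \<in> closure (heis_ball x \<epsilon>)" for y
      using closure_heis_ball_strip[OF x that] B by (cases "y \<in> \<Omega>") (auto simp: extended_domain_def)
  qed
qed

lemma small_radius_exists:
  fixes m0 m1 b :: real
  assumes "0 < m0" "0 \<le> m1" "0 < b"
  shows "\<exists>e>0. e \<le> 1 \<and> (\<forall>\<epsilon>. 0 < \<epsilon> \<and> \<epsilon> \<le> e \<longrightarrow> \<epsilon> ^ 4 \<le> m0 / 2 \<and> b * (20 * (m1 + 2)) * \<epsilon>\<^sup>2 \<le> 1 / 2)"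
proof -
  define a where "a = b * (20 * (m1 + 2))"
  define e where "e = min 1 (min (m0 / 2) (1 / (2 * a)))"
  have a: "0 < a" using assms by (simp add: a_def)
  have e: "0 < e" "e \<le> 1" using assms a by (auto simp: e_def)
  have "\<epsilon> ^ 4 \<le> m0 / 2 \<and> b * (20 * (m1 + 2)) * \<epsilon>\<^sup>2 \<le> 1 / 2" if \<epsilon>: "0 < \<epsilon>" "\<epsilon> \<le> e" for \<epsilon>
  proof
    have "\<epsilon> ^ 4 \<le> \<epsilon> ^ 1" "\<epsilon>\<^sup>2 \<le> \<epsilon> ^ 1" using \<epsilon> by (intro power_decreasing; simp add: e_def)+
    then have le: "\<epsilon> ^ 4 \<le> e" "\<epsilon>\<^sup>2 \<le> e" using \<epsilon> by auto
    show "\<epsilon> ^ 4 \<le> m0 / 2" using le by (simp add: e_def)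
    have "a * \<epsilon>\<^sup>2 \<le> a * (1 / (2 * a))" using le a by (intro mult_left_mono) (auto simp: e_def)
    also have "a * (1 / (2 * a)) = 1 / 2" using a by simp
    finally show "b * (20 * (m1 + 2)) * \<epsilon>\<^sup>2 \<le> 1 / 2" unfolding a_def .
  qed
  with e show ?thesis by blast
qed

text \<open>Comparison on all of \<open>\<Omega>\<close>, with a barrier whose pole lies at distance at least \<open>1\<close> from \<open>\<Omega>\<close>.\<close>
lemma uniform_upper_bound:
  assumes "bounded \<Omega>"
  shows "\<exists>e>0. \<forall>p \<epsilon> u G C. 2 \<le> p \<and> 0 < \<epsilon> \<and> \<epsilon> \<le> e \<and> Lp_centre_bvp \<Omega> G p \<epsilon> u \<and>
       (\<forall>y\<in>boundary_strip \<Omega> \<epsilon>. G y \<le> C) \<longrightarrow> (\<forall>x\<in>\<Omega>. u x \<le> C + 1)"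
proof -
  obtain R where R: "\<And>x. x \<in> \<Omega> \<Longrightarrow> norm x \<le> R" using assms by (auto simp: bounded_iff)
  \<comment> \<open>The first coordinate of the pole exceeds that of every point of
    \<open>\<Omega>\<close> by at least \<open>1\<close>, so the annulus starts at
    \<open>m0 = 1\<close>.\<close>
  define z :: "real ^ 3" where "z = vector [R + 1, 0, 0]"
  define M where "M x = gauge_pow4 (heis_mult (heis_inv z) x)" for x
  have comp: "compact (M ` closure \<Omega>)"
    unfolding M_def using assms by (intro compact_continuous_image continuous_intros) (simp add: compact_closure)
  obtain m where "\<forall>t\<in>M ` closure \<Omega>. norm t \<le> m"
    using compact_imp_bounded[OF comp] unfolding bounded_iff by (elim exE) (rule that)
  then have m: "M x \<le> m" if "x \<in> \<Omega>" for x
    using that closure_subset[of \<Omega>] by (force simp: abs_le_iff)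
  have M1: "1 \<le> M x" if "x \<in> \<Omega>" for x
  proof -
    have "\<bar>x $ 1\<bar> \<le> R" using R[OF that] component_le_norm_cart[of x 1] by simp
    then have "\<bar>1\<bar> \<le> \<bar>heis_mult (heis_inv z) x $ 1\<bar>"
      by (simp add: z_def heis_inv_def)
    then have "1 \<le> (heis_mult (heis_inv z) x $ 1)\<^sup>2"
      unfolding abs_le_square_iff by simp
    then have "1\<^sup>2 \<le> ((heis_mult (heis_inv z) x $ 1)\<^sup>2 + (heis_mult (heis_inv z) x $ 2)\<^sup>2)\<^sup>2"
      by (intro power_mono) (auto simp: add_increasing2 simp del: heis_mult_nth)
    then show ?thesis using sum_squares_le_gauge_pow4[of "heis_mult (heis_inv z) x"] by (simp add: M_def)
  qed
  obtain e where e: "0 < e" "e \<le> 1"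
    "\<forall>\<epsilon>. 0 < \<epsilon> \<and> \<epsilon> \<le> e \<longrightarrow> \<epsilon> ^ 4 \<le> 1 / 2 \<and> 400000 / 1 * (20 * (max 1 m + 2)) * \<epsilon>\<^sup>2 \<le> 1 / 2"
  proof -
    have "(0::real) \<le> max 1 m" "(0::real) < 400000 / 1" by auto
    from small_radius_exists[OF zero_less_one this] show thesis by (elim exE conjE) (rule that)
  qed
  show ?thesis
  proof (rule exI[of _ e], intro conjI allI impI ballI e(1))
    fix p \<epsilon> u G C x
    assume *: "2 \<le> p \<and> 0 < \<epsilon> \<and> \<epsilon> \<le> e \<and> Lp_centre_bvp \<Omega> G p \<epsilon> u \<and> (\<forall>y\<in>boundary_strip \<Omega> \<epsilon>. G y \<le> C)"
      and x: "x \<in> \<Omega>"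
    from * have A: "2 \<le> p" "0 < \<epsilon>" "\<epsilon> \<le> e" "Lp_centre_bvp \<Omega> G p \<epsilon> u"
      and G: "\<And>y. y \<in> boundary_strip \<Omega> \<epsilon> \<Longrightarrow> G y \<le> C" by auto
    have e34: "\<epsilon> ^ 4 \<le> 1 / 2" "400000 / 1 * (20 * (max 1 m + 2)) * \<epsilon>\<^sup>2 \<le> 1 / 2"
      using e(3) A(2,3) by blast+
    \<comment> \<open>With \<open>A = 1\<close> the barrier takes values between \<open>C\<close>
      and \<open>C + 1\<close> everywhere: it dominates the boundary data and bounds
      \<open>u\<close> inside.\<close>
    have "u x \<le> (C + 1) - 1 * exp (- (400000 / 1 * M x))"
      unfolding M_def
    proof (rule Lp_centre_bvp_comparison[OF A(4) subset_refl A(1) _ _ _ refl A(2) _ e34 _ _ x])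
      show "1 \<le> gauge_pow4 (heis_mult (heis_inv z) x) \<and> gauge_pow4 (heis_mult (heis_inv z) x) \<le> max 1 m"
        if "x \<in> \<Omega>" for x
        using M1[OF that] m[OF that] by (auto simp: M_def)
      fix x y assume "x \<in> \<Omega>" "y \<in> closure (heis_ball x \<epsilon>)" "y \<notin> \<Omega>"
      then have y: "y \<in> boundary_strip \<Omega> \<epsilon>" by (rule closure_heis_ball_strip)
      then have "u y \<le> C" using A(4) G by (simp add: Lp_centre_bvp_def)
      moreover have "exp (- (400000 / 1 * gauge_pow4 (heis_mult (heis_inv z) y))) \<le> 1" by simp
      ultimately show "u y \<le> (C + 1) - 1 * exp (- (400000 / 1 * gauge_pow4 (heis_mult (heis_inv z) y)))"
        by linarith
    qed (use A e in auto)
    then show "u x \<le> C + 1" by (smt (verit) exp_gt_zero)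
  qed
qed

section \<open>Decay of the excess across scales\<close>

text \<open>The ratio of the rise of the barrier from distance \<open>\<mu> r / 2\<close> to
  \<open>2 r\<close> to its rise from \<open>\<mu> r / 2\<close> to \<open>3 r\<close>;
  \<open>16\<close> and \<open>81\<close> are fourth powers of \<open>2\<close> and
  \<open>3\<close>. As \<open>b\<close> is inversely proportional to \<open>r ^ 4\<close>, the scale
  cancels.\<close>

definition decay_factor :: "real \<Rightarrow> real" where
  "decay_factor \<mu> = (let \<nu> = (\<mu> / 2) ^ 4 in
     (1 - exp (- (400000 / \<nu> * (16 - \<nu>)))) / (1 - exp (- (400000 / \<nu> * (81 - \<nu>)))))"

lemma decay_factor_bounds:
  assumes "0 < \<mu>" "\<mu> < 1"
  shows "0 < decay_factor \<mu>" "decay_factor \<mu> < 1"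
proof -
  define \<nu> where "\<nu> = (\<mu> / 2) ^ 4"
  have \<nu>: "0 < \<nu>" "\<nu> < 1" using assms by (auto simp: \<nu>_def power_less_one_iff)
  have "0 < 400000 / \<nu> * (16 - \<nu>)" "400000 / \<nu> * (16 - \<nu>) < 400000 / \<nu> * (81 - \<nu>)"
    using \<nu> by (intro mult_pos_pos mult_strict_left_mono divide_pos_pos; simp)+
  then show "0 < decay_factor \<mu>" "decay_factor \<mu> < 1"
    unfolding decay_factor_def Let_def \<nu>_def[symmetric] by (auto simp: divide_less_eq_1)
qed

text \<open>The predicate fixes the order of quantifiers: \<open>e\<close> may depend on the scale
  \<open>r\<close>, but is chosen before the exponent, the solution, the data and the centres
  \<open>y\<close> and \<open>z\<close>.\<close>

definition decay_step_radius :: "(real ^ 3) set \<Rightarrow> real \<Rightarrow> real \<Rightarrow> real \<Rightarrow> bool" where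
  "decay_step_radius \<Omega> \<mu> r e \<longleftrightarrow> (\<forall>p \<epsilon> u G y z c V.
     2 \<le> p \<and> 0 < \<epsilon> \<and> \<epsilon> \<le> e \<and> Lp_centre_bvp \<Omega> G p \<epsilon> u \<and>
     heis_ball z (\<mu> * r) \<subseteq> heis_ball y r - \<Omega> \<and> 0 < V \<and>
     (\<forall>x\<in>heis_ball y (5 * r) \<inter> boundary_strip \<Omega> \<epsilon>. G x \<le> c) \<and>
     (\<forall>x\<in>heis_ball y (5 * r) \<inter> \<Omega>. u x \<le> c + V) \<longrightarrow>
     (\<forall>x\<in>heis_ball y r \<inter> \<Omega>. u x \<le> c + decay_factor \<mu> * V))"

text \<open>The pole \<open>z\<close> is within \<open>r\<close> of \<open>y\<close>. Points of the
  ball of radius \<open>r\<close> about \<open>y\<close> are thus within \<open>2 r\<close> of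
  \<open>z\<close>, whereas points outside the ball of radius \<open>4 r\<close> are at least
  \<open>3 r\<close> away. The barrier is at least \<open>c\<close> at the exterior points reached,
  at least \<open>c + V\<close> at the points of \<open>\<Omega>\<close> reached outside the
  \<open>4 r\<close> ball, and has not risen fully on the inner ball.\<close>

lemma decay_step:
  assumes \<mu>: "0 < \<mu>" "\<mu> < 1" and r: "0 < r"
  shows "\<exists>e>0. decay_step_radius \<Omega> \<mu> r e"
proof -
  define \<nu> where "\<nu> = (\<mu> / 2) ^ 4"
  define m0 where "m0 = (\<mu> / 2 * r) ^ 4"
  define m1 where "m1 = (5 * r) ^ 4"
  define b where "b = 400000 / m0"
  have \<nu>: "0 < \<nu>" "\<nu> < 1" using \<mu> by (auto simp: \<nu>_def power_less_one_iff)
  have m0: "0 < m0" "m0 = \<nu> * r ^ 4" using \<mu> r by (simp_all only: m0_def \<nu>_def power_mult_distrib) auto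
  have m01: "m0 \<le> m1" unfolding m0_def m1_def using \<mu> r by (intro power_mono mult_right_mono) auto
  have b0: "0 < b" using m0 by (simp add: b_def)
  have br: "b * (k * r ^ 4 - m0) = 400000 / \<nu> * (k - \<nu>)" for k
    using \<nu> r by (simp add: b_def m0 field_simps)
  have "0 \<le> m1" using m0 m01 by simp
  from small_radius_exists[OF m0(1) this b0]
  obtain e where e: "0 < e" "e \<le> 1"
    "\<forall>\<epsilon>. 0 < \<epsilon> \<and> \<epsilon> \<le> e \<longrightarrow> \<epsilon> ^ 4 \<le> m0 / 2 \<and> b * (20 * (m1 + 2)) * \<epsilon>\<^sup>2 \<le> 1 / 2"
    by (elim exE conjE) (rule that)
  \<comment> \<open>A jump of length \<open>\<epsilon>\<close> from a point of
    \<open>\<Omega>\<close> must stay at distance \<open>\<mu> r / 2\<close> from \<open>z\<close>,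
    half of the clearance, and from the ball of radius \<open>4 r\<close> it must not leave that of
    radius \<open>5 r\<close>.\<close>
  define e' where "e' = min e (\<mu> / 2 * r)"
  have \<mu>r: "\<mu> / 2 * r \<le> r" using \<mu> r by (simp add: mult_left_le_one_le)
  have e': "0 < e'" "e' \<le> e" "e' \<le> \<mu> / 2 * r" using e(1) \<mu> r by (simp_all add: e'_def)
  then have e'r: "e' \<le> r" using \<mu>r by linarith
  have "decay_step_radius \<Omega> \<mu> r e'"
    unfolding decay_step_radius_def
  proof (intro allI impI ballI)
    fix p \<epsilon> u G y z c V x
    assume *: "2 \<le> p \<and> 0 < \<epsilon> \<and> \<epsilon> \<le> e' \<and> Lp_centre_bvp \<Omega> G p \<epsilon> u \<and>
     heis_ball z (\<mu> * r) \<subseteq> heis_ball y r - \<Omega> \<and> 0 < V \<and>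
     (\<forall>x\<in>heis_ball y (5 * r) \<inter> boundary_strip \<Omega> \<epsilon>. G x \<le> c) \<and>
     (\<forall>x\<in>heis_ball y (5 * r) \<inter> \<Omega>. u x \<le> c + V)"
      and x: "x \<in> heis_ball y r \<inter> \<Omega>"
    from * have p: "2 \<le> p" and \<epsilon>: "0 < \<epsilon>" "\<epsilon> \<le> e'" and bvp: "Lp_centre_bvp \<Omega> G p \<epsilon> u"
      and z: "heis_ball z (\<mu> * r) \<subseteq> heis_ball y r - \<Omega>" and V: "0 < V"
      and G: "\<And>x. x \<in> heis_ball y (5 * r) \<inter> boundary_strip \<Omega> \<epsilon> \<Longrightarrow> G x \<le> c"
      and uV: "\<And>x. x \<in> heis_ball y (5 * r) \<inter> \<Omega> \<Longrightarrow> u x \<le> c + V"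
      by blast+
    define M where "M x = gauge_pow4 (heis_mult (heis_inv z) x)" for x
    define q where "q k = 1 - exp (- (400000 / \<nu> * (k - \<nu>)))" for k
    \<comment> \<open>The amplitude for which the barrier is \<open>c\<close> at distance
      \<open>\<mu> r / 2\<close> and \<open>c + V\<close> at distance \<open>3 r\<close> from
      \<open>z\<close>.\<close>
    define A where "A = V * exp (b * m0) / q 81"
    define D where "D = heis_ball y (4 * r) \<inter> \<Omega>"
    have q81: "0 < q 81" using \<nu> by (auto simp: q_def intro!: mult_pos_pos)
    have A: "0 < A" using V q81 by (simp add: A_def)
    have M_le: "M w \<le> s ^ 4" if "heis_dist z w \<le> s" "0 \<le> s" for w s
      using that by (simp add: M_def heis_dist_le_iff)
    have M_ge: "s ^ 4 \<le> M w" if "s \<le> heis_dist z w" "0 \<le> s" for w s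
      using that heis_dist_less_iff[of s z w] by (simp add: M_def linorder_not_less[symmetric])
    have W: "c + A * exp (- (b * m0)) - A * exp (- (b * (k * r ^ 4))) = c + V * (q k / q 81)" for k
    proof -
      have "exp (- (b * (k * r ^ 4))) = exp (- (b * m0)) * exp (- (b * (k * r ^ 4 - m0)))"
        by (simp add: exp_add[symmetric] algebra_simps)
      then have "A * exp (- (b * m0)) - A * exp (- (b * (k * r ^ 4))) = A * exp (- (b * m0)) * q k"
        unfolding br q_def by (simp add: algebra_simps)
      also have "\<dots> = V * (q k / q 81)" by (simp add: A_def exp_minus)
      finally show ?thesis by simp
    qed
    have half: "\<mu> / 2 * r = \<mu> * r / 2" "0 < \<mu> * r" using \<mu> r by auto
    have "z \<in> heis_ball z (\<mu> * r)" using \<mu> r by (simp add: heis_ball_def)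
    from subsetD[OF z this] have yz: "heis_dist y z < r" by (simp add: heis_ball_def)
    have zx: "\<mu> * r \<le> heis_dist z x" if "x \<in> \<Omega>" for x
    proof (rule ccontr)
      assume "\<not> ?thesis"
      then have "x \<in> heis_ball z (\<mu> * r)" by (simp add: heis_ball_def)
      then show False using z that by blast
    qed
    have "u x \<le> c + A * exp (- (b * m0)) - A * exp (- (b * M x))"
      unfolding M_def
    proof (rule Lp_centre_bvp_comparison[OF bvp _ p A m0(1) m01 b_def \<epsilon>(1)])
      show "D \<subseteq> \<Omega>" by (auto simp: D_def)
      show "\<epsilon> \<le> 1" "\<epsilon> ^ 4 \<le> m0 / 2" "b * (20 * (m1 + 2)) * \<epsilon>\<^sup>2 \<le> 1 / 2"
        using e(2,3) \<epsilon> e'(2) by (fastforce intro: order_trans)+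
      show "x \<in> D" using x r by (auto simp: D_def heis_ball_def)
      show "m0 \<le> gauge_pow4 (heis_mult (heis_inv z) w) \<and> gauge_pow4 (heis_mult (heis_inv z) w) \<le> m1"
        if "w \<in> D" for w
      proof -
        have "\<mu> / 2 * r \<le> heis_dist z w" using zx[of w] that half by (auto simp: D_def)
        moreover have "heis_dist z w \<le> 5 * r"
          using heis_dist_triangle[of z w y] heis_dist_commute[of y z] yz that by (auto simp: D_def heis_ball_def)
        ultimately show ?thesis
          using M_ge[of "\<mu> / 2 * r" w] M_le[of w "5 * r"] r half unfolding m0_def m1_def M_def by auto
      qed
      fix w s assume w: "w \<in> D" and s: "s \<in> closure (heis_ball w \<epsilon>)" "s \<notin> D"
      have ws: "heis_dist w s \<le> \<epsilon>" using closure_heis_ball_le[OF s(1)] .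
      have ys: "heis_dist y s < 5 * r"
        using heis_dist_triangle[of y s w] ws \<epsilon> e'r w by (auto simp: D_def heis_ball_def)
      have "\<mu> / 2 * r \<le> heis_dist z s"
      proof -
        have "\<mu> * r \<le> heis_dist z w" using zx[of w] w by (simp add: D_def)
        then show ?thesis
          using heis_dist_triangle[of z w s] heis_dist_commute[of s w] ws \<epsilon> e'(3) half by linarith
      qed
      then have "m0 \<le> M s" using M_ge[of "\<mu> / 2 * r" s] half unfolding m0_def by auto
      then have "A * exp (- (b * M s)) \<le> A * exp (- (b * m0))"
        using A b0 by simp
      then have Wc: "c \<le> c + A * exp (- (b * m0)) - A * exp (- (b * M s))" by simp
      show "u s \<le> c + A * exp (- (b * m0)) - A * exp (- (b * gauge_pow4 (heis_mult (heis_inv z) s)))"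
        unfolding M_def[symmetric]
      proof (cases "s \<in> \<Omega>")
        case False
        then have st: "s \<in> boundary_strip \<Omega> \<epsilon>"
          using closure_heis_ball_strip[of w \<Omega> s \<epsilon>] w s by (auto simp: D_def)
        then have "u s = G s" using bvp by (simp add: Lp_centre_bvp_def)
        also have "\<dots> \<le> c" using G[of s] st ys by (simp add: heis_ball_def)
        finally show "u s \<le> c + A * exp (- (b * m0)) - A * exp (- (b * M s))" using Wc by simp
      next
        case True
        then have "4 * r \<le> heis_dist y s" using s by (auto simp: D_def heis_ball_def)
        then have "3 * r \<le> heis_dist z s" using heis_dist_triangle[of y s z] yz by linarith
        then have "81 * r ^ 4 \<le> M s" using M_ge[of "3 * r" s] r by (simp add: power_mult_distrib)
        then have "A * exp (- (b * M s)) \<le> A * exp (- (b * (81 * r ^ 4)))" using A b0 by simp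
        moreover have "u s \<le> c + V" using uV[of s] True ys by (simp add: heis_ball_def)
        moreover have "c + A * exp (- (b * m0)) - A * exp (- (b * (81 * r ^ 4))) = c + V"
          unfolding W using q81 by simp
        ultimately show "u s \<le> c + A * exp (- (b * m0)) - A * exp (- (b * M s))" by linarith
      qed
    qed
    moreover have "M x \<le> 16 * r ^ 4"
    proof -
      have "heis_dist z x \<le> 2 * r"
        using heis_dist_triangle[of z x y] heis_dist_commute[of y z] yz x by (auto simp: heis_ball_def)
      then show ?thesis using M_le[of x "2 * r"] r by (simp add: power_mult_distrib)
    qed
    then have "A * exp (- (b * (16 * r ^ 4))) \<le> A * exp (- (b * M x))" using A b0 by simp
    ultimately have "u x \<le> c + V * (q 16 / q 81)" unfolding W[symmetric] by linarith
    also have "q 16 / q 81 = decay_factor \<mu>" unfolding q_def decay_factor_def Let_def \<nu>_def ..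
    finally show "u x \<le> c + decay_factor \<mu> * V" by (simp add: mult.commute)
  qed
  then show ?thesis using e'(1) by blast
qed

definition decay_radius :: "(real ^ 3) set \<Rightarrow> real \<Rightarrow> real \<Rightarrow> nat \<Rightarrow> real \<Rightarrow> bool" where
  "decay_radius \<Omega> \<mu> \<delta> k e \<longleftrightarrow> (\<forall>p \<epsilon> u G y c V.
     2 \<le> p \<and> 0 < \<epsilon> \<and> \<epsilon> \<le> e \<and> Lp_centre_bvp \<Omega> G p \<epsilon> u \<and> 0 < V \<and>
     (\<forall>r\<in>{0<..\<delta>}. \<exists>z. heis_ball z (\<mu> * r) \<subseteq> heis_ball y r - \<Omega>) \<and>
     (\<forall>x\<in>heis_ball y (5 * \<delta>) \<inter> boundary_strip \<Omega> \<epsilon>. G x \<le> c) \<and>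
     (\<forall>x\<in>\<Omega>. u x \<le> c + V) \<longrightarrow>
     (\<forall>x\<in>heis_ball y (5 * \<delta> / 5 ^ k) \<inter> \<Omega>. u x \<le> c + decay_factor \<mu> ^ k * V))"

text \<open>At scale \<open>r = \<delta> / 5 ^ k\<close> a step leads from the ball of radius
  \<open>5 r\<close> to that of radius \<open>r\<close>, which is five times the next scale. Each
  step brings its own threshold for \<open>\<epsilon>\<close>; finitely many have a positive
  minimum.\<close>

lemma decay_iterate:
  assumes \<mu>: "0 < \<mu>" "\<mu> < 1" and \<delta>: "0 < \<delta>"
  shows "\<exists>e>0. decay_radius \<Omega> \<mu> \<delta> k e"
proof (induction k)
  case 0
  have "decay_radius \<Omega> \<mu> \<delta> 0 1" by (simp add: decay_radius_def)
  then show ?case using zero_less_one by blast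
next
  case (Suc k)
  then obtain e1 where e1: "0 < e1" "decay_radius \<Omega> \<mu> \<delta> k e1" by blast
  define r where "r = \<delta> / 5 ^ k"
  have "\<delta> * 1 \<le> \<delta> * 5 ^ k" using \<delta> by (intro mult_left_mono) auto
  then have r: "0 < r" "r \<le> \<delta>" using \<delta> by (simp_all add: r_def pos_divide_le_eq)
  obtain e2 where e2: "0 < e2" "decay_step_radius \<Omega> \<mu> r e2"
    using decay_step[OF \<mu> r(1)] by blast
  have "decay_radius \<Omega> \<mu> \<delta> (Suc k) (min e1 e2)"
    unfolding decay_radius_def
  proof (intro allI impI)
    fix p \<epsilon> u G y c V
    assume *: "2 \<le> p \<and> 0 < \<epsilon> \<and> \<epsilon> \<le> min e1 e2 \<and> Lp_centre_bvp \<Omega> G p \<epsilon> u \<and> 0 < V \<and>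
     (\<forall>r\<in>{0<..\<delta>}. \<exists>z. heis_ball z (\<mu> * r) \<subseteq> heis_ball y r - \<Omega>) \<and>
     (\<forall>x\<in>heis_ball y (5 * \<delta>) \<inter> boundary_strip \<Omega> \<epsilon>. G x \<le> c) \<and>
     (\<forall>x\<in>\<Omega>. u x \<le> c + V)"
    then have "2 \<le> p \<and> 0 < \<epsilon> \<and> \<epsilon> \<le> e1 \<and> Lp_centre_bvp \<Omega> G p \<epsilon> u \<and> 0 < V \<and>
     (\<forall>r\<in>{0<..\<delta>}. \<exists>z. heis_ball z (\<mu> * r) \<subseteq> heis_ball y r - \<Omega>) \<and>
     (\<forall>x\<in>heis_ball y (5 * \<delta>) \<inter> boundary_strip \<Omega> \<epsilon>. G x \<le> c) \<and>
     (\<forall>x\<in>\<Omega>. u x \<le> c + V)"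
      by (elim conjE) (intro conjI; simp)
    from e1(2)[unfolded decay_radius_def, THEN spec, THEN spec, THEN spec, THEN spec,
        THEN spec, THEN spec, THEN spec, THEN mp, OF this]
    have u: "\<forall>x\<in>heis_ball y (5 * r) \<inter> \<Omega>. u x \<le> c + decay_factor \<mu> ^ k * V"
      by (simp add: r_def)
    have "r \<in> {0<..\<delta>}" using r by simp
    then obtain z where z: "heis_ball z (\<mu> * r) \<subseteq> heis_ball y r - \<Omega>" using * by blast
    have V: "0 < decay_factor \<mu> ^ k * V" using * decay_factor_bounds[OF \<mu>] by simp
    have "heis_ball y (5 * r) \<subseteq> heis_ball y (5 * \<delta>)" using r by (auto simp: heis_ball_def)
    then have "\<forall>x\<in>heis_ball y (5 * r) \<inter> boundary_strip \<Omega> \<epsilon>. G x \<le> c" using * by blast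
    then have "2 \<le> p \<and> 0 < \<epsilon> \<and> \<epsilon> \<le> e2 \<and> Lp_centre_bvp \<Omega> G p \<epsilon> u \<and>
     heis_ball z (\<mu> * r) \<subseteq> heis_ball y r - \<Omega> \<and> 0 < decay_factor \<mu> ^ k * V \<and>
     (\<forall>x\<in>heis_ball y (5 * r) \<inter> boundary_strip \<Omega> \<epsilon>. G x \<le> c) \<and>
     (\<forall>x\<in>heis_ball y (5 * r) \<inter> \<Omega>. u x \<le> c + decay_factor \<mu> ^ k * V)"
      using * by (intro conjI z V u) simp_all
    from e2(2)[unfolded decay_step_radius_def, THEN spec, THEN spec, THEN spec, THEN spec,
        THEN spec, THEN spec, THEN spec, THEN spec, THEN mp, OF this]
    show "\<forall>x\<in>heis_ball y (5 * \<delta> / 5 ^ Suc k) \<inter> \<Omega>. u x \<le> c + decay_factor \<mu> ^ Suc k * V"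
      by (simp add: r_def mult.assoc)
  qed
  then show ?case using e1(1) e2(1) by (metis min_less_iff_conj)
qed

section \<open>From decay to the two-sided boundary estimate\<close>

text \<open>The radii are chosen before \<open>G\<close>, which enters only through the bound
  \<open>C\<close>; hence the same radii serve \<open>G\<close> and \<open>- G\<close>.\<close>

definition boundary_radii :: "(real ^ 3) set \<Rightarrow> real \<Rightarrow> real \<Rightarrow> real \<Rightarrow> real \<Rightarrow> real \<Rightarrow> real \<Rightarrow> bool" where
  "boundary_radii \<Omega> \<mu> \<delta> \<eta> C d e \<longleftrightarrow> (\<forall>p \<epsilon> u G y.
     2 \<le> p \<and> 0 < \<epsilon> \<and> \<epsilon> < 1 \<and> \<epsilon> \<le> e \<and> Lp_centre_bvp \<Omega> G p \<epsilon> u \<and> y \<in> frontier \<Omega> \<and>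
     (\<forall>x\<in>boundary_strip \<Omega> 1. \<bar>G x\<bar> \<le> C) \<and>
     (\<forall>r\<in>{0<..\<delta>}. \<exists>z. heis_ball z (\<mu> * r) \<subseteq> heis_ball y r - \<Omega>) \<and>
     (\<forall>x\<in>heis_ball y (5 * \<delta>) \<inter> boundary_strip \<Omega> \<epsilon>. G x \<le> G y + \<eta> / 2) \<longrightarrow>
     (\<forall>x\<in>heis_ball y d \<inter> \<Omega>. u x \<le> G y + \<eta>))"

lemma one_sided_boundary_estimate:
  fixes \<Omega> :: "(real ^ 3) set" and C :: real
  assumes \<Omega>: "open \<Omega>" "bounded \<Omega>" and \<mu>: "0 < \<mu>" "\<mu> < 1" and \<delta>: "0 < \<delta>" and \<eta>: "0 < \<eta>" and C: "0 \<le> C"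
  shows "\<exists>d e. 0 < d \<and> 0 < e \<and> boundary_radii \<Omega> \<mu> \<delta> \<eta> C d e"
proof -
  \<comment> \<open>\<open>u\<close> is at most \<open>C + 1\<close> and \<open>G y\<close> at least
    \<open>- C\<close>, so the initial excess over \<open>G y + \<eta> / 2\<close> is at most
    \<open>2 * C + 1\<close>. The iteration brings it down to the remaining
    \<open>\<eta> / 2\<close>.\<close>
  define V where "V = 2 * C + 1"
  have V: "0 < V" using C by (simp add: V_def)
  note \<theta> = decay_factor_bounds[OF \<mu>]
  have "0 < \<eta> / 2 / V" using \<eta> V by simp
  then obtain k where "decay_factor \<mu> ^ k < \<eta> / 2 / V"
    using real_arch_pow_inv \<theta>(2) by blast
  then have k: "decay_factor \<mu> ^ k * V \<le> \<eta> / 2"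
    using V by (simp add: pos_less_divide_eq del: divide_divide_eq_left)
  obtain e1 where e1: "0 < e1"
    "\<forall>p \<epsilon> u G C. 2 \<le> p \<and> 0 < \<epsilon> \<and> \<epsilon> \<le> e1 \<and> Lp_centre_bvp \<Omega> G p \<epsilon> u \<and>
       (\<forall>y\<in>boundary_strip \<Omega> \<epsilon>. G y \<le> C) \<longrightarrow> (\<forall>x\<in>\<Omega>. u x \<le> C + 1)"
    using uniform_upper_bound[OF \<Omega>(2)] by (elim exE conjE) (rule that)
  obtain e2 where e2: "0 < e2" "decay_radius \<Omega> \<mu> \<delta> k e2"
    using decay_iterate[OF \<mu> \<delta>] by blast
  have "boundary_radii \<Omega> \<mu> \<delta> \<eta> C (5 * \<delta> / 5 ^ k) (min e1 e2)"
    unfolding boundary_radii_def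
  proof (intro allI impI)
    fix p \<epsilon> u G y
    assume *: "2 \<le> p \<and> 0 < \<epsilon> \<and> \<epsilon> < 1 \<and> \<epsilon> \<le> min e1 e2 \<and> Lp_centre_bvp \<Omega> G p \<epsilon> u \<and> y \<in> frontier \<Omega> \<and>
     (\<forall>x\<in>boundary_strip \<Omega> 1. \<bar>G x\<bar> \<le> C) \<and>
     (\<forall>r\<in>{0<..\<delta>}. \<exists>z. heis_ball z (\<mu> * r) \<subseteq> heis_ball y r - \<Omega>) \<and>
     (\<forall>x\<in>heis_ball y (5 * \<delta>) \<inter> boundary_strip \<Omega> \<epsilon>. G x \<le> G y + \<eta> / 2)"
    have "y \<in> boundary_strip \<Omega> 1" using frontier_subset_boundary_strip[OF \<Omega>(1), of 1] * by auto
    then have Gy: "\<bar>G y\<bar> \<le> C" using * by blast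
    have "boundary_strip \<Omega> \<epsilon> \<subseteq> boundary_strip \<Omega> 1" using * by (auto simp: boundary_strip_def)
    then have "\<forall>w\<in>boundary_strip \<Omega> \<epsilon>. G w \<le> C" using * by (meson abs_le_D1 subsetD)
    then have "2 \<le> p \<and> 0 < \<epsilon> \<and> \<epsilon> \<le> e1 \<and> Lp_centre_bvp \<Omega> G p \<epsilon> u \<and>
       (\<forall>y\<in>boundary_strip \<Omega> \<epsilon>. G y \<le> C)"
      using * by (intro conjI) simp_all
    from e1(2)[THEN spec, THEN spec, THEN spec, THEN spec, THEN spec, THEN mp, OF this] have "\<forall>w\<in>\<Omega>. u w \<le> C + 1" .
    moreover have "C + 1 \<le> (G y + \<eta> / 2) + V" using Gy \<eta> by (simp add: V_def abs_le_iff)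
    ultimately have uV: "\<forall>w\<in>\<Omega>. u w \<le> (G y + \<eta> / 2) + V" by (meson order_trans)
    have "2 \<le> p \<and> 0 < \<epsilon> \<and> \<epsilon> \<le> e2 \<and> Lp_centre_bvp \<Omega> G p \<epsilon> u \<and> 0 < V \<and>
     (\<forall>r\<in>{0<..\<delta>}. \<exists>z. heis_ball z (\<mu> * r) \<subseteq> heis_ball y r - \<Omega>) \<and>
     (\<forall>x\<in>heis_ball y (5 * \<delta>) \<inter> boundary_strip \<Omega> \<epsilon>. G x \<le> G y + \<eta> / 2) \<and>
     (\<forall>x\<in>\<Omega>. u x \<le> (G y + \<eta> / 2) + V)"
      using * by (intro conjI V uV) simp_all
    from e2(2)[unfolded decay_radius_def, THEN spec, THEN spec, THEN spec, THEN spec,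
        THEN spec, THEN spec, THEN spec, THEN mp, OF this]
    have "\<forall>x\<in>heis_ball y (5 * \<delta> / 5 ^ k) \<inter> \<Omega>. u x \<le> (G y + \<eta> / 2) + decay_factor \<mu> ^ k * V" .
    moreover have "(G y + \<eta> / 2) + decay_factor \<mu> ^ k * V \<le> G y + \<eta>" using k by linarith
    ultimately show "\<forall>x\<in>heis_ball y (5 * \<delta> / 5 ^ k) \<inter> \<Omega>. u x \<le> G y + \<eta>" by (meson order_trans)
  qed
  moreover have "0 < 5 * \<delta> / 5 ^ k" "0 < min e1 e2" using \<delta> e1(1) e2(1) by auto
  ultimately show ?thesis by blast
qed

lemma boundary_estimate:
  fixes \<Omega> :: "(real ^ 3) set" and G :: "real ^ 3 \<Rightarrow> real"
  assumes \<Omega>: "open \<Omega>" "bounded \<Omega>" and G: "continuous_on (boundary_strip \<Omega> 1) G"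
    and corkscrew: "exterior_corkscrew \<Omega> \<delta>' \<mu>" and \<eta>: "0 < \<eta>" and scale: "continuity_scale \<Omega> G \<delta>' \<eta> \<delta>"
  shows "\<exists>d e. 0 < d \<and> 0 < e \<and> (\<forall>p \<epsilon> u. 2 \<le> p \<and> 0 < \<epsilon> \<and> \<epsilon> < 1 \<and> \<epsilon> \<le> e \<and>
      solves_p_mean_bvp \<Omega> G p \<epsilon> u \<longrightarrow> (\<forall>y\<in>frontier \<Omega>. \<forall>x\<in>heis_ball y d \<inter> \<Omega>. \<bar>u x - G y\<bar> \<le> \<eta>))"
\<comment> \<open>For empty \<open>\<Omega>\<close> the infimum in \<open>heis_infdist\<close>
  ranges over the empty set and the strip need not be compact, but the claim is vacuous.\<close>
proof (cases "\<Omega> = {}")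
  case True
  then show ?thesis by (intro exI[of _ 1]) simp
next
  case False
  have \<mu>: "0 < \<mu>" "\<mu> < 1" and z: "\<And>r y. 0 < r \<Longrightarrow> r < \<delta>' \<Longrightarrow> y \<in> frontier \<Omega> \<Longrightarrow>
      \<exists>z. heis_ball z (\<mu> * r) \<subset> heis_ball y r - \<Omega>"
    using corkscrew by (auto simp: exterior_corkscrew_def)
  have \<delta>: "0 < \<delta>" "\<delta> < \<delta>'" and Gs: "\<And>\<epsilon> y x. 0 < \<epsilon> \<Longrightarrow> \<epsilon> < 1 \<Longrightarrow> y \<in> frontier \<Omega> \<Longrightarrow>
      x \<in> heis_ball y (5 * \<delta>) \<inter> boundary_strip \<Omega> \<epsilon> \<Longrightarrow> \<bar>G x - G y\<bar> \<le> \<eta> / 2"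
    using scale unfolding continuity_scale_def by blast+
  have "bounded (G ` boundary_strip \<Omega> 1)"
    using compact_boundary_strip[OF \<Omega> False] G by (intro compact_imp_bounded compact_continuous_image)
  then obtain C where C: "\<forall>x\<in>boundary_strip \<Omega> 1. \<bar>G x\<bar> \<le> C"
    by (auto simp: bounded_iff)
  then have C': "\<forall>x\<in>boundary_strip \<Omega> 1. \<bar>G x\<bar> \<le> \<bar>C\<bar>" by (meson abs_ge_self order_trans)
  obtain d e where de: "0 < d" "0 < e" "boundary_radii \<Omega> \<mu> \<delta> \<eta> \<bar>C\<bar> d e"
    using one_sided_boundary_estimate[OF \<Omega> \<mu> \<delta>(1) \<eta>, of "\<bar>C\<bar>"] by auto
  have upper: "u x \<le> G y + \<eta>"
    if "2 \<le> p \<and> 0 < \<epsilon> \<and> \<epsilon> < 1 \<and> \<epsilon> \<le> e \<and> Lp_centre_bvp \<Omega> G p \<epsilon> u \<and> y \<in> frontier \<Omega> \<and>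
     (\<forall>x\<in>boundary_strip \<Omega> 1. \<bar>G x\<bar> \<le> \<bar>C\<bar>) \<and>
     (\<forall>r\<in>{0<..\<delta>}. \<exists>z. heis_ball z (\<mu> * r) \<subseteq> heis_ball y r - \<Omega>) \<and>
     (\<forall>x\<in>heis_ball y (5 * \<delta>) \<inter> boundary_strip \<Omega> \<epsilon>. G x \<le> G y + \<eta> / 2)" "x \<in> heis_ball y d \<inter> \<Omega>"
    for p \<epsilon> u G x y
    using de(3)[unfolded boundary_radii_def, THEN spec, THEN spec, THEN spec, THEN spec, THEN spec, THEN mp, OF that(1)] that(2) by (rule bspec)
  have "\<bar>u x - G y\<bar> \<le> \<eta>" if p: "2 \<le> p" and \<epsilon>: "0 < \<epsilon>" "\<epsilon> < 1" "\<epsilon> \<le> e"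
    and u: "solves_p_mean_bvp \<Omega> G p \<epsilon> u" and y: "y \<in> frontier \<Omega>" and x: "x \<in> heis_ball y d \<inter> \<Omega>"
    for p \<epsilon> u y x
  proof -
    have bvp: "Lp_centre_bvp \<Omega> G p \<epsilon> u"
      using u p \<epsilon> by (intro solves_p_mean_bvp_imp_Lp_centre_bvp) auto
    have z': "\<forall>r\<in>{0<..\<delta>}. \<exists>z. heis_ball z (\<mu> * r) \<subseteq> heis_ball y r - \<Omega>"
    proof
      fix r assume "r \<in> {0<..\<delta>}"
      then show "\<exists>z. heis_ball z (\<mu> * r) \<subseteq> heis_ball y r - \<Omega>"
        using z[of r y] y \<delta> by auto
    qed
    have G1: "\<forall>w\<in>heis_ball y (5 * \<delta>) \<inter> boundary_strip \<Omega> \<epsilon>. G w \<le> G y + \<eta> / 2"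
      and G2: "\<forall>w\<in>heis_ball y (5 * \<delta>) \<inter> boundary_strip \<Omega> \<epsilon>. - G w \<le> - G y + \<eta> / 2"
      using Gs[OF \<epsilon>(1,2) y] by (smt (verit))+
    have "u x \<le> G y + \<eta>"
      using p \<epsilon> bvp y C' z' G1 by (intro upper[OF _ x] conjI)
    moreover have "- u x \<le> - G y + \<eta>"
    proof (rule upper[where G = "\<lambda>x. - G x" and u = "\<lambda>x. - u x", OF _ x], intro conjI)
      show "\<forall>w\<in>boundary_strip \<Omega> 1. \<bar>- G w\<bar> \<le> \<bar>C\<bar>" using C' by simp
    qed (fact p \<epsilon> Lp_centre_bvp_uminus[OF bvp] y z' G2)+
    ultimately show ?thesis by linarith
  qed
  then show ?thesis using de(1,2) by blast
qed

theorem theorem1p11: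
  fixes \<Omega> :: "(real ^ 3) set" and G :: "real ^ 3 \<Rightarrow> real"
  assumes "open \<Omega>" and "bounded \<Omega>"
    and "continuous_on (boundary_strip \<Omega> 1) G"
  shows
    "\<exists>(\<delta>\<^sub>0 :: real \<Rightarrow> real \<Rightarrow> real \<Rightarrow> real) (\<epsilon>\<^sub>0 :: real \<Rightarrow> real \<Rightarrow> real \<Rightarrow> real).
    \<forall>\<delta>' \<mu> p \<eta> \<delta>.
      exterior_corkscrew \<Omega> \<delta>' \<mu> \<and> 2 \<le> p \<and> 0 < \<eta> \<and> continuity_scale \<Omega> G \<delta>' \<eta> \<delta> \<longrightarrow>
        0 < \<delta>\<^sub>0 \<eta> \<mu> p \<and> 0 < \<epsilon>\<^sub>0 \<eta> \<delta> \<mu> \<and>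
        (\<forall>\<epsilon> u. 0 < \<epsilon> \<and> \<epsilon> < 1 \<and> \<epsilon> \<le> \<epsilon>\<^sub>0 \<eta> \<delta> \<mu> \<and> solves_p_mean_bvp \<Omega> G p \<epsilon> u \<longrightarrow>
           (\<forall>y\<in>frontier \<Omega>. \<forall>x\<in>heis_ball y (\<delta>\<^sub>0 \<eta> \<mu> p) \<inter> \<Omega>. \<bar>u x - G y\<bar> \<le> \<eta>))"
proof -
  define P where "P \<eta> \<mu> d e \<longleftrightarrow> 0 < d \<and> 0 < e \<and> (\<forall>p \<epsilon> u. 2 \<le> p \<and> 0 < \<epsilon> \<and> \<epsilon> < 1 \<and> \<epsilon> \<le> e \<and>
      solves_p_mean_bvp \<Omega> G p \<epsilon> u \<longrightarrow> (\<forall>y\<in>frontier \<Omega>. \<forall>x\<in>heis_ball y d \<inter> \<Omega>. \<bar>u x - G y\<bar> \<le> \<eta>))"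
    for \<eta> \<mu> d e :: real
  text \<open>The conclusion does not mention \<open>\<delta>\<close>, and the barrier works for all \<open>p\<close> at once, so one
    choice of radii serves for every admissible \<open>\<delta>\<close> and \<open>p\<close>.\<close>
  have *: "\<exists>d e. P \<eta> \<mu> d e" if hyps: "exterior_corkscrew \<Omega> \<delta>' \<mu>" "0 < \<eta>" "continuity_scale \<Omega> G \<delta>' \<eta> \<delta>"
    for \<delta>' \<mu> \<eta> \<delta>
    unfolding P_def by (rule boundary_estimate[OF assms hyps])
  \<comment> \<open>\<open>P\<close> does not mention the corkscrew radius \<open>\<delta>'\<close>
    either, so one witness for \<open>\<eta>\<close> and \<open>\<mu>\<close> is valid whichever
    \<open>\<delta>'\<close> produced it.\<close>
  define d where "d \<eta> \<mu> = (SOME d. \<exists>e. P \<eta> \<mu> d e)" for \<eta> \<mu>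
  define e where "e \<eta> \<mu> = (SOME e. P \<eta> \<mu> (d \<eta> \<mu>) e)" for \<eta> \<mu>
  have choice: "P \<eta> \<mu> (d \<eta> \<mu>) (e \<eta> \<mu>)" if "\<exists>d e. P \<eta> \<mu> d e" for \<eta> \<mu>
    using someI_ex[OF someI_ex[OF that]] unfolding d_def e_def .
  show ?thesis
  proof (rule exI[of _ "\<lambda>\<eta> \<mu> (p::real). d \<eta> \<mu>"], rule exI[of _ "\<lambda>\<eta> (\<delta>::real) \<mu>. e \<eta> \<mu>"], intro allI impI)
    fix \<delta>' \<mu> p \<eta> \<delta> :: real
    assume hyps: "exterior_corkscrew \<Omega> \<delta>' \<mu> \<and> 2 \<le> p \<and> 0 < \<eta> \<and> continuity_scale \<Omega> G \<delta>' \<eta> \<delta>"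
    then have "P \<eta> \<mu> (d \<eta> \<mu>) (e \<eta> \<mu>)" using choice * by blast
    then show "0 < d \<eta> \<mu> \<and> 0 < e \<eta> \<mu> \<and>
        (\<forall>\<epsilon> u. 0 < \<epsilon> \<and> \<epsilon> < 1 \<and> \<epsilon> \<le> e \<eta> \<mu> \<and> solves_p_mean_bvp \<Omega> G p \<epsilon> u \<longrightarrow>
           (\<forall>y\<in>frontier \<Omega>. \<forall>x\<in>heis_ball y (d \<eta> \<mu>) \<inter> \<Omega>. \<bar>u x - G y\<bar> \<le> \<eta>))"
      using hyps unfolding P_def by (elim conjE) (intro conjI; blast)
  qed
qed

end
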